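(* Let $d\ge1$, $L,\gamma>0$, $\varepsilon>0$, and let $U$ satisfy the standing assumptions in the context. Define the quadratic saddle current through the hyperplane $\Sigma_\sigma^{\rm lin}=\{z\in\mathbb R^{3d}:\Lambda_\sigma(z)=0\}$ by $$\mathfrak C_{\sigma,\varepsilon}^{\rm quad}=\frac1{Z_\varepsilon}\int_{\Sigma_\sigma^{\rm lin}}-\varepsilon\,e^{-H_\sigma^{\rm quad}/\varepsilon}\,\mathsf M\nabla\psi_\varepsilon\cdot n_\sigma\,dS,\qquad \psi_\varepsilon=\Phi_\sigma(\Lambda_\sigma/\sqrt\varepsilon),\quad n_\sigma=\nabla\Lambda_\sigma/|\nabla\Lambda_\sigma|.$$ Then $$\mathfrak C_{\sigma,\varepsilon}^{\rm quad}=\frac1{Z_\varepsilon}\frac{(2\pi\varepsilon)^{3d/2}}{L^d}\frac{\mu_\sigma}{2\pi\sqrt{-\det H_\sigma}}e^{-U(\sigma)/\varepsilon}=\frac{\mu_\sigma}{2\pi\sqrt{-\det H_\sigma}}\,\mathfrak K_{\sigma,\varepsilon},\qquad \mathfrak K_{\sigma,\varepsilon}:=Z_\varepsilon^{-1}\frac{(2\pi\varepsilon)^{3d/2}}{L^d}e^{-U(\sigma)/\varepsilon}.$$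
   Context: Standing assumptions on the potential. $U\in C^\infty(\mathbb R^d)$ is a Morse function with exactly two local minima $m,s$. With $\Gamma(m,s)$ the set of continuous paths $\omega:[0,1]\to\mathbb R^d$ from $m$ to $s$ and $h_{m,s}=\inf_{\omega\in\Gamma(m,s)}\max_{t}U(\omega(t))$, assume $h_{m,s}=U(\sigma)>\max\{U(m),U(s)\}$ and that the height is realized by a unique index-one saddle point $\sigma$. $\nabla^2U(m)$ is positive definite; $H_\sigma=\nabla^2U(\sigma)$ has exactly one negative eigenvalue $-\lambda_\sigma<0$ and $d-1$ positive eigenvalues $\lambda_2^\sigma,\dots,\lambda_d^\sigma$. With $\Omega_m,\Omega_s$ the components of $\{U<U(\sigma)\}$ containing $m,s$: $\operatorname{Crit}(U)\cap\Omega_i=\{i\}$, $\sigma\in\partial\Omega_m\cap\partial\Omega_s$, and the only critical point of $U$ in $\partial\Omega_i\cap\{U=U(\sigma)\}$ is $\sigma$ ($i\in\{m,s\}$). Moreover $U$ is bounded below and, after adding a constant, $U\ge0$, with compact sublevel sets; there are $c_0,R_0>0$ with $\theta\cdot\nabla U(\theta)\ge c_0(|\theta|^2+U(\theta))$ for $|\theta|\ge R_0$; $\nabla U$ and all its derivatives grow at most polynomially; there is $\beta>0$ with $\liminf_{|\theta|\to\infty}(|\nabla U|-\beta\Delta U)>0$; and $\frac{|\nabla U|^2}{(1+U)(1+\theta\cdot\nabla U)}\to0$ as $|\theta|\to\infty$. Notation. $z=(\theta,p,r)\in\mathbb R^{3d}$, $H(z)=U(\theta)+\frac L2|p|^2+\frac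 L2|r|^2$, $Z_\varepsilon=\int_{\mathbb R^{3d}}e^{-H/\varepsilon}dz$. $e_\sigma$ is a unit eigenvector of $H_\sigma$ for $-\lambda_\sigma$; $(q,v,w)$ are the coordinates of $(\theta-\sigma,p,r)$ in an orthonormal eigenbasis of $H_\sigma$ whose first vector is $e_\sigma$ (so $q_1=\langle\theta-\sigma,e_\sigma\rangle$, etc.). $$H_\sigma^{\rm quad}=U(\sigma)-\tfrac{\lambda_\sigma}2q_1^2+\tfrac12\sum_{i=2}^d\lambda_i^\sigma q_i^2+\tfrac L2|v|^2+\tfrac L2|w|^2 .$$ $\mu_\sigma>0$ is the unique positive root of $\mu^3+\gamma\mu^2+(\gamma^2-\lambda_\sigma/L)\mu-\gamma\lambda_\sigma/L=0$; $\alpha_\sigma=\frac{\lambda_\sigma}{L\mu_\sigma}$, $\zeta_\sigma=\frac{\gamma}{\mu_\sigma+\gamma}$, $c_\sigma=\frac\gamma L\zeta_\sigma^2$; $$\Lambda_\sigma(\theta,p,r)=\alpha_\sigma\langle\theta-\sigma,e_\sigma\rangle+\langle p,e_\sigma\rangle+\zeta_\sigma\langle r,e_\sigma\rangle,\qquad \Phi_\sigma(x)=\frac{\int_x^\infty e^{-\mu_\sigma y^2/(2c_\sigma)}dy}{\int_{-\infty}^\infty e^{-\mu_\sigma y^2/(2c_\sigma)}dy}.$$ In block form with respect to $(\theta,p,r)$, $$\mathsf M=\begin{pmatrix}0&L^{-1}I_d&0\\-L^{-1}I_d&0&\gamma L^{-1}I_d\\0&-\gamma L^{-1}I_d&\gamma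 L^{-1}I_d\end{pmatrix},$$ for which the generator of the third-order Langevin diffusion linearized at $(\sigma,0,0)$ is $\mathcal L_{\sigma,\varepsilon}f=\varepsilon e^{H_\sigma^{\rm quad}/\varepsilon}\nabla\cdot(e^{-H_\sigma^{\rm quad}/\varepsilon}\mathsf M\nabla f)$. $dS$ is the $(3d-1)$-dimensional surface measure. *)

theory Defs
  imports "HOL-Analysis.Analysis"
begin

subsection \<open>Calculus\<close>

definition grad :: "('a::real_inner \<Rightarrow> real) \<Rightarrow> 'a \<Rightarrow> 'a" where
  "grad f x = (THE D. GDERIV f x :> D)"

definition hess :: "(real^'n \<Rightarrow> real) \<Rightarrow> real^'n \<Rightarrow> real^'n^'n" where
  "hess f x = jacobian (grad f) (at x)"

definition laplacian :: "(real^'n \<Rightarrow> real) \<Rightarrow> real^'n \<Rightarrow> real" where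
  "laplacian f x = trace (hess f x)"

fun iter_partial :: "'a::euclidean_space list \<Rightarrow> ('a \<Rightarrow> real) \<Rightarrow> 'a \<Rightarrow> real" where
  "iter_partial [] f = f"
| "iter_partial (b # bs) f = (\<lambda>x. frechet_derivative (iter_partial bs f) (at x) b)"

text \<open>\<open>C\<^sup>\<infinity>\<close>: every iterated partial derivative is differentiable, hence in particular
  exists and is continuous.\<close>

definition smooth :: "('a::euclidean_space \<Rightarrow> real) \<Rightarrow> bool" where
  "smooth f \<longleftrightarrow> (\<forall>bs x. set bs \<subseteq> Basis \<longrightarrow> iter_partial bs f differentiable (at x))"

definition poly_growth :: "('a::euclidean_space \<Rightarrow> real) \<Rightarrow> bool" where
  "poly_growth f \<longleftrightarrow> (\<exists>C k::nat. \<forall>x. \<bar>f x\<bar> \<le> real C * (1 + norm x) ^ k)"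

definition crit :: "('a::real_inner \<Rightarrow> real) \<Rightarrow> 'a set" where
  "crit f = {x. grad f x = 0}"

definition local_minima :: "('a::topological_space \<Rightarrow> real) \<Rightarrow> 'a set" where
  "local_minima f = {x. eventually (\<lambda>y. f x \<le> f y) (nhds x)}"

definition morse :: "(real^'n \<Rightarrow> real) \<Rightarrow> bool" where
  "morse f \<longleftrightarrow> (\<forall>x\<in>crit f. invertible (hess f x))"

text \<open>Number of eigenvalues in \<open>P\<close>, counted with (geometric) multiplicity; it is only applied to
  Hessians, which are symmetric.\<close>

definition eigenspace :: "real^'n^'n \<Rightarrow> real \<Rightarrow> (real^'n) set" where
  "eigenspace A k = {v. A *v v = k *\<^sub>R v}"

definition eigenvalue_count :: "real^'n^'n \<Rightarrow> real set \<Rightarrow> nat" where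
  "eigenvalue_count A P = (\<Sum>k | k \<in> P \<and> eigenspace A k \<noteq> {0}. dim (eigenspace A k))"

definition index_one_saddle :: "(real^'n \<Rightarrow> real) \<Rightarrow> real^'n \<Rightarrow> bool" where
  "index_one_saddle f x \<longleftrightarrow> x \<in> crit f \<and> eigenvalue_count (hess f x) {..<0} = 1"

subsection \<open>The double-well potential\<close>

definition paths_between :: "'a::topological_space \<Rightarrow> 'a \<Rightarrow> (real \<Rightarrow> 'a) set" where
  "paths_between x y = {\<omega>. path \<omega> \<and> pathstart \<omega> = x \<and> pathfinish \<omega> = y}"

definition path_height :: "('a \<Rightarrow> real) \<Rightarrow> (real \<Rightarrow> 'a) \<Rightarrow> real" where
  "path_height U \<omega> = (SUP t\<in>{0..1}. U (\<omega> t))"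

definition comm_height :: "('a::topological_space \<Rightarrow> real) \<Rightarrow> 'a \<Rightarrow> 'a \<Rightarrow> real" where
  "comm_height U x y = (INF \<omega>\<in>paths_between x y. path_height U \<omega>)"

text \<open>\<open>z\<close> realizes the communication height of \<open>x\<close> and \<open>y\<close> if it is a highest point
  of some optimal path.\<close>

definition realizes_height :: "('a::topological_space \<Rightarrow> real) \<Rightarrow> 'a \<Rightarrow> 'a \<Rightarrow> 'a \<Rightarrow> bool" where
  "realizes_height U x y z \<longleftrightarrow> U z = comm_height U x y \<and>
     (\<exists>\<omega>\<in>paths_between x y. path_height U \<omega> = comm_height U x y \<and> z \<in> path_image \<omega>)"

definition well :: "('a::topological_space \<Rightarrow> real) \<Rightarrow> 'a \<Rightarrow> 'a \<Rightarrow> 'a set" where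
  "well U \<sigma> x = connected_component_set {y. U y < U \<sigma>} x"

locale double_well =
  fixes U :: "real^'n \<Rightarrow> real" and m s \<sigma> :: "real^'n"
  assumes smooth: "smooth U"
    and morse: "morse U"
    and minima: "m \<noteq> s" "local_minima U = {m, s}"
    and height: "comm_height U m s = U \<sigma>" "U \<sigma> > max (U m) (U s)"
    and saddle: "index_one_saddle U \<sigma>" "realizes_height U m s \<sigma>"
    and saddle_unique: "\<And>x. index_one_saddle U x \<Longrightarrow> realizes_height U m s x \<Longrightarrow> x = \<sigma>"
    and hess_m: "\<And>v. v \<noteq> 0 \<Longrightarrow> v \<bullet> (hess U m *v v) > 0"
    and hess_saddle: "eigenvalue_count (hess U \<sigma>) {..<0} = 1"
      "eigenvalue_count (hess U \<sigma>) {0<..} = CARD('n) - 1"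
    and crit_well: "\<And>i. i \<in> {m, s} \<Longrightarrow> crit U \<inter> well U \<sigma> i = {i}"
    and saddle_frontier: "\<sigma> \<in> frontier (well U \<sigma> m) \<inter> frontier (well U \<sigma> s)"
    and crit_frontier:
      "\<And>i. i \<in> {m, s} \<Longrightarrow> crit U \<inter> (frontier (well U \<sigma> i) \<inter> {x. U x = U \<sigma>}) = {\<sigma>}"
    and nonneg: "\<And>x. U x \<ge> 0"
    and compact_sublevel: "\<And>c. compact {x. U x \<le> c}"
    and dissipative: "\<exists>c0>0. \<exists>R0>0. \<forall>x. norm x \<ge> R0 \<longrightarrow> x \<bullet> grad U x \<ge> c0 * ((norm x)\<^sup>2 + U x)"
    and derivatives_growth: "\<And>bs. bs \<noteq> [] \<Longrightarrow> set bs \<subseteq> Basis \<Longrightarrow> poly_growth (iter_partial bs U)"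
    and grad_laplacian:
      "\<exists>\<beta>>0. Liminf at_infinity (\<lambda>x. ereal (norm (grad U x) - \<beta> * laplacian U x)) > 0"
    and grad_ratio:
      "((\<lambda>x. (norm (grad U x))\<^sup>2 / ((1 + U x) * (1 + x \<bullet> grad U x))) \<longlongrightarrow> 0) at_infinity"

text \<open>\<open>e 1, \<dots>, e d\<close> is an orthonormal eigenbasis of \<open>A\<close>, the eigenvalue of \<open>e 1\<close> being
  \<open>-l\<^sub>\<sigma> < 0\<close> and that of \<open>e i\<close>, for \<open>2 \<le> i \<le> d\<close>, being \<open>lam i > 0\<close>.\<close>

definition saddle_eigenbasis ::
    "real^'n^'n \<Rightarrow> real \<Rightarrow> (nat \<Rightarrow> real) \<Rightarrow> (nat \<Rightarrow> real^'n) \<Rightarrow> bool" where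
  "saddle_eigenbasis A l\<^sub>\<sigma> lam e \<longleftrightarrow>
     (\<forall>i\<in>{1..CARD('n)}. \<forall>j\<in>{1..CARD('n)}. e i \<bullet> e j = (if i = j then 1 else 0)) \<and>
     l\<^sub>\<sigma> > 0 \<and> A *v e 1 = (- l\<^sub>\<sigma>) *\<^sub>R e 1 \<and>
     (\<forall>i\<in>{2..CARD('n)}. lam i > 0 \<and> A *v e i = lam i *\<^sub>R e i)"

subsection \<open>Third-order Langevin dynamics near the saddle\<close>

text \<open>Points of \<open>\<real>\<^sup>3\<^sup>d\<close> are triples \<open>(\<theta>, p, r)\<close>; the product type carries the Euclidean inner product
  and \<^term>\<open>lborel\<close> on it is \<open>3d\<close>-dimensional Lebesgue measure.\<close>

type_synonym 'n phase = "(real^'n) \<times> (real^'n) \<times> (real^'n)"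

definition hamiltonian :: "(real^'n \<Rightarrow> real) \<Rightarrow> real \<Rightarrow> 'n phase \<Rightarrow> real" where
  "hamiltonian U L = (\<lambda>(\<theta>, p, r). U \<theta> + L / 2 * (norm p)\<^sup>2 + L / 2 * (norm r)\<^sup>2)"

definition partition_fn :: "(real^'n \<Rightarrow> real) \<Rightarrow> real \<Rightarrow> real \<Rightarrow> real" where
  "partition_fn U L \<epsilon> = (\<integral>z. exp (- hamiltonian U L z / \<epsilon>) \<partial>lborel)"

definition quad_hamiltonian :: "(real^'n \<Rightarrow> real) \<Rightarrow> real \<Rightarrow> real^'n \<Rightarrow> real \<Rightarrow> (nat \<Rightarrow> real) \<Rightarrow>
    (nat \<Rightarrow> real^'n) \<Rightarrow> 'n phase \<Rightarrow> real" where
  "quad_hamiltonian U L \<sigma> l\<^sub>\<sigma> lam e = (\<lambda>(\<theta>, p, r).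
     let q = (\<lambda>i. (\<theta> - \<sigma>) \<bullet> e i); v = (\<lambda>i. p \<bullet> e i); w = (\<lambda>i. r \<bullet> e i); d = CARD('n) in
     U \<sigma> - l\<^sub>\<sigma> / 2 * (q 1)\<^sup>2 + 1 / 2 * (\<Sum>i=2..d. lam i * (q i)\<^sup>2)
       + L / 2 * (\<Sum>i=1..d. (v i)\<^sup>2) + L / 2 * (\<Sum>i=1..d. (w i)\<^sup>2))"

definition mu_sigma :: "real \<Rightarrow> real \<Rightarrow> real \<Rightarrow> real" where
  "mu_sigma L \<gamma> l\<^sub>\<sigma> = (THE \<mu>. \<mu> > 0 \<and>
     \<mu>^3 + \<gamma> * \<mu>^2 + (\<gamma>^2 - l\<^sub>\<sigma> / L) * \<mu> - \<gamma> * l\<^sub>\<sigma> / L = 0)"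

definition alpha_sigma :: "real \<Rightarrow> real \<Rightarrow> real \<Rightarrow> real" where
  "alpha_sigma L \<gamma> l\<^sub>\<sigma> = l\<^sub>\<sigma> / (L * mu_sigma L \<gamma> l\<^sub>\<sigma>)"

definition zeta_sigma :: "real \<Rightarrow> real \<Rightarrow> real \<Rightarrow> real" where
  "zeta_sigma L \<gamma> l\<^sub>\<sigma> = \<gamma> / (mu_sigma L \<gamma> l\<^sub>\<sigma> + \<gamma>)"

definition c_sigma :: "real \<Rightarrow> real \<Rightarrow> real \<Rightarrow> real" where
  "c_sigma L \<gamma> l\<^sub>\<sigma> = \<gamma> / L * (zeta_sigma L \<gamma> l\<^sub>\<sigma>)\<^sup>2"

definition Lambda_sigma ::
    "real \<Rightarrow> real \<Rightarrow> real^'n \<Rightarrow> real \<Rightarrow> real^'n \<Rightarrow> 'n phase \<Rightarrow> real" where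
  "Lambda_sigma L \<gamma> \<sigma> l\<^sub>\<sigma> e\<^sub>\<sigma> = (\<lambda>(\<theta>, p, r).
     alpha_sigma L \<gamma> l\<^sub>\<sigma> * ((\<theta> - \<sigma>) \<bullet> e\<^sub>\<sigma>) + p \<bullet> e\<^sub>\<sigma> + zeta_sigma L \<gamma> l\<^sub>\<sigma> * (r \<bullet> e\<^sub>\<sigma>))"

definition Phi_sigma :: "real \<Rightarrow> real \<Rightarrow> real \<Rightarrow> real \<Rightarrow> real" where
  "Phi_sigma L \<gamma> l\<^sub>\<sigma> x =
     (LINT y:{x..}|lborel. exp (- mu_sigma L \<gamma> l\<^sub>\<sigma> * y\<^sup>2 / (2 * c_sigma L \<gamma> l\<^sub>\<sigma>))) /
     (LINT y|lborel. exp (- mu_sigma L \<gamma> l\<^sub>\<sigma> * y\<^sup>2 / (2 * c_sigma L \<gamma> l\<^sub>\<sigma>)))"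

definition psi_eps ::
    "real \<Rightarrow> real \<Rightarrow> real^'n \<Rightarrow> real \<Rightarrow> real^'n \<Rightarrow> real \<Rightarrow> 'n phase \<Rightarrow> real" where
  "psi_eps L \<gamma> \<sigma> l\<^sub>\<sigma> e\<^sub>\<sigma> \<epsilon> z =
     Phi_sigma L \<gamma> l\<^sub>\<sigma> (Lambda_sigma L \<gamma> \<sigma> l\<^sub>\<sigma> e\<^sub>\<sigma> z / sqrt \<epsilon>)"

text \<open>The action on \<open>(a, b, c)\<close> of the block matrix with rows
  \<open>(0, L\<^sup>-\<^sup>1 I, 0)\<close>, \<open>(-L\<^sup>-\<^sup>1 I, 0, \<gamma> L\<^sup>-\<^sup>1 I)\<close>, \<open>(0, -\<gamma> L\<^sup>-\<^sup>1 I, \<gamma> L\<^sup>-\<^sup>1 I)\<close>.\<close>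

definition M_op :: "real \<Rightarrow> real \<Rightarrow> 'n::finite phase \<Rightarrow> 'n phase" where
  "M_op L \<gamma> = (\<lambda>(a, b, c).
     ((1 / L) *\<^sub>R b,
      (- (1 / L)) *\<^sub>R a + (\<gamma> / L) *\<^sub>R c,
      (- (\<gamma> / L)) *\<^sub>R b + (\<gamma> / L) *\<^sub>R c))"

subsection \<open>Surface measure on affine subspaces\<close>

text \<open>The \<open>k\<close>-dimensional surface measure on a \<open>k\<close>-dimensional affine subspace \<open>S\<close>: the image of Lebesgue
  measure on \<open>\<real>\<^sup>k\<close> (here \<open>\<real>\<^sup>B\<close> with \<open>k = card B\<close>) under an isometric parametrization
  \<open>x \<mapsto> a + (\<Sum>b\<in>B. x b b)\<close> of \<open>S\<close>, where \<open>a \<in> S\<close> and \<open>B\<close> is an orthonormal basis of the direction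
  space. By the translation and rotation invariance of Lebesgue measure, the choice of \<open>a\<close> and \<open>B\<close>
  is immaterial.\<close>

definition affine_frame :: "'a::euclidean_space set \<Rightarrow> 'a \<times> 'a set \<Rightarrow> bool" where
  "affine_frame S = (\<lambda>(a, B). pairwise orthogonal B \<and> (\<forall>b\<in>B. norm b = 1) \<and> S = (+) a ` span B)"

definition surface_measure :: "'a::euclidean_space set \<Rightarrow> 'a measure" where
  "surface_measure S = (case SOME aB. affine_frame S aB of (a, B) \<Rightarrow>
     distr (Pi\<^sub>M B (\<lambda>_. lborel)) borel (\<lambda>x. a + (\<Sum>b\<in>B. x b *\<^sub>R b)))"

subsection \<open>The quadratic saddle current\<close>

definition Sigma_lin :: "real \<Rightarrow> real \<Rightarrow> real^'n \<Rightarrow> real \<Rightarrow> real^'n \<Rightarrow> 'n phase set" where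
  "Sigma_lin L \<gamma> \<sigma> l\<^sub>\<sigma> e\<^sub>\<sigma> = {z. Lambda_sigma L \<gamma> \<sigma> l\<^sub>\<sigma> e\<^sub>\<sigma> z = 0}"

definition n_sigma :: "real \<Rightarrow> real \<Rightarrow> real^'n \<Rightarrow> real \<Rightarrow> real^'n \<Rightarrow> 'n phase \<Rightarrow> 'n phase" where
  "n_sigma L \<gamma> \<sigma> l\<^sub>\<sigma> e\<^sub>\<sigma> z =
     (1 / norm (grad (Lambda_sigma L \<gamma> \<sigma> l\<^sub>\<sigma> e\<^sub>\<sigma>) z)) *\<^sub>R grad (Lambda_sigma L \<gamma> \<sigma> l\<^sub>\<sigma> e\<^sub>\<sigma>) z"

definition quad_current :: "(real^'n \<Rightarrow> real) \<Rightarrow> real \<Rightarrow> real \<Rightarrow> real^'n \<Rightarrow> real \<Rightarrow> (nat \<Rightarrow> real) \<Rightarrow>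
    (nat \<Rightarrow> real^'n) \<Rightarrow> real \<Rightarrow> real" where
  "quad_current U L \<gamma> \<sigma> l\<^sub>\<sigma> lam e \<epsilon> =
     1 / partition_fn U L \<epsilon> *
     (LINT z:Sigma_lin L \<gamma> \<sigma> l\<^sub>\<sigma> (e 1)|surface_measure (Sigma_lin L \<gamma> \<sigma> l\<^sub>\<sigma> (e 1)).
        - \<epsilon> * exp (- quad_hamiltonian U L \<sigma> l\<^sub>\<sigma> lam e z / \<epsilon>) *
        (M_op L \<gamma> (grad (psi_eps L \<gamma> \<sigma> l\<^sub>\<sigma> (e 1) \<epsilon>) z) \<bullet> n_sigma L \<gamma> \<sigma> l\<^sub>\<sigma> (e 1) z))"

definition K_sigma :: "(real^'n \<Rightarrow> real) \<Rightarrow> real \<Rightarrow> real^'n \<Rightarrow> real \<Rightarrow> real" where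
  "K_sigma U L \<sigma> \<epsilon> = inverse (partition_fn U L \<epsilon>) *
     ((2 * pi * \<epsilon>) powr (3 * real CARD('n) / 2) / L ^ CARD('n)) * exp (- U \<sigma> / \<epsilon>)"

end

theory Submission
  imports Defs "HOL-Probability.Distributions"
begin

text \<open>
The current through the hyperplane \<open>\<Lambda> = 0\<close> is a Gaussian surface integral. On the hyperplane the gradient
of \<open>\<psi>\<close> is a constant multiple of the normal \<open>N = \<nabla>\<Lambda>\<close>, and \<open>M N \<bullet> N\<close> is the constant \<open>c\<close>, since the
antisymmetric part of \<open>M\<close> does not contribute. The integrand is therefore a constant times
\<open>exp (- H / \<epsilon>)\<close> with \<open>H\<close> quadratic (\<open>current_density\<close>).

The quadratic form \<open>H\<close> is indefinite, but its restriction to the hyperplane is positive definite, and the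
hyperplane has an orthonormal frame diagonalizing this restriction, which is written down explicitly.
Each eigenvector of the Hessian spans an \<open>\<real>\<^sup>3\<close> of phase space. For a positive eigenvalue \<open>\<lambda>\<^sub>i\<close>, this \<open>\<real>\<^sup>3\<close> lies
in the direction space of the hyperplane and contributes the values \<open>\<lambda>\<^sub>i, L, L\<close> of the form. For the negative
eigenvalue, the hyperplane cuts out a plane of this \<open>\<real>\<^sup>3\<close>, on which the form has values \<open>L\<close> and \<open>L l c / (\<mu> |N|\<^sup>2)\<close>;
the second value is where the cubic equation for \<open>\<mu>\<close> enters (\<open>saddle_constants_identity\<close>). In the product of
the one-dimensional Gaussian integrals, \<open>|N|\<close> and \<open>c\<close> cancel against the constants of the integrand, which
leaves \<open>\<mu>\<close> and the eigenvalues of the Hessian, whose product is its determinant.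

The surface measure is defined through an arbitrarily chosen orthonormal frame. That the explicit frame may
be used instead is rotation invariance of Lebesgue measure on a subspace. It is derived from
translation invariance by the argument for uniqueness of Haar measure (\<open>nn_integral_frame_unique\<close>,
\<open>surface_measure_eq\<close>).
\<close>

section \<open>Lebesgue measure in orthonormal coordinates\<close>

abbreviation coord_measure :: "'b set \<Rightarrow> ('b \<Rightarrow> real) measure" where
  "coord_measure B \<equiv> Pi\<^sub>M B (\<lambda>_. lborel)"

abbreviation comb :: "'a::real_vector set \<Rightarrow> ('a \<Rightarrow> real) \<Rightarrow> 'a" where
  "comb B x \<equiv> \<Sum>b\<in>B. x b *\<^sub>R b"

lemma has_bochner_integral_gaussian:
  fixes k :: real
  assumes "k > 0"
  shows "has_bochner_integral lborel (\<lambda>x. exp (- (k * x\<^sup>2) / 2)) (sqrt (2 * pi / k))"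
proof -
  have "exp (- (k * x\<^sup>2) / 2) = sqrt (2 * pi / k) * normal_density 0 (1 / sqrt k) x" for x
    using assms by (simp add: normal_density_def power_divide real_sqrt_divide field_simps)
  moreover have "has_bochner_integral lborel
      (\<lambda>x. sqrt (2 * pi / k) * normal_density 0 (1 / sqrt k) x) (sqrt (2 * pi / k) * 1)"
    using assms by (intro has_bochner_integral_mult_right) (auto simp: has_bochner_integral_iff)
  ultimately show ?thesis
    by simp
qed

lemma has_bochner_integral_diagonal_gaussian:
  fixes k :: "'b \<Rightarrow> real"
  assumes "finite B" and "\<And>b. b \<in> B \<Longrightarrow> k b > 0"
  shows "has_bochner_integral (coord_measure B) (\<lambda>x. exp (- (\<Sum>b\<in>B. k b * (x b)\<^sup>2) / 2))
           (\<Prod>b\<in>B. sqrt (2 * pi / k b))"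
proof -
  interpret product_sigma_finite "\<lambda>_::'b. lborel :: real measure"
    by standard
  have exp_sum: "exp (- (\<Sum>b\<in>B. k b * (x b)\<^sup>2) / 2) = (\<Prod>b\<in>B. exp (- (k b * (x b)\<^sup>2) / 2))" for x
    using assms(1) by (simp add: exp_sum sum_negf[symmetric] sum_divide_distrib)
  have "integrable lborel (\<lambda>t. exp (- (k b * t\<^sup>2) / 2))"
    and "(LINT t|lborel. exp (- (k b * t\<^sup>2) / 2)) = sqrt (2 * pi / k b)" if "b \<in> B" for b
    using has_bochner_integral_gaussian[OF assms(2)[OF that]] by (auto simp: has_bochner_integral_iff)
  then show ?thesis
    unfolding exp_sum has_bochner_integral_iff
    using product_integral_prod[OF assms(1), of "\<lambda>b t. exp (- (k b * t\<^sup>2) / 2)"]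
      product_integrable_prod[OF assms(1), of "\<lambda>b t. exp (- (k b * t\<^sup>2) / 2)"]
    by (metis (no_types, lifting) prod.cong)
qed

lemma norm_orthonormal_comb:
  fixes B :: "'a::real_inner set"
  assumes "finite B" "pairwise orthogonal B" "\<And>b. b \<in> B \<Longrightarrow> norm b = 1"
  shows "(norm (comb B x))\<^sup>2 = (\<Sum>b\<in>B. (x b)\<^sup>2)"
proof -
  have "(norm (comb B x))\<^sup>2 = (\<Sum>b\<in>B. (norm (x b *\<^sub>R b))\<^sup>2)"
    using assms(1,2)
    by (intro norm_sum_Pythagorean) (auto simp: pairwise_def orthogonal_clauses orthogonal_def)
  also have "\<dots> = (\<Sum>b\<in>B. (x b)\<^sup>2)"
    using assms(3) by (intro sum.cong) auto
  finally show ?thesis .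
qed

text \<open>The Gaussian \<open>exp (- |y|\<^sup>2 / 2)\<close> only depends on the norm, so its integral in orthonormal coordinates is
independent of the frame. It normalizes the uniqueness argument below.\<close>
lemma nn_integral_frame_gaussian:
  fixes B :: "'a::euclidean_space set"
  assumes "finite B" "pairwise orthogonal B" "\<And>b. b \<in> B \<Longrightarrow> norm b = 1"
  shows "(\<integral>\<^sup>+x. ennreal (exp (- (norm (comb B x))\<^sup>2 / 2)) \<partial>coord_measure B) = ennreal (sqrt (2 * pi) ^ card B)"
proof -
  have "has_bochner_integral (coord_measure B) (\<lambda>x. exp (- (norm (comb B x))\<^sup>2 / 2)) (sqrt (2 * pi) ^ card B)"
    using has_bochner_integral_diagonal_gaussian[OF assms(1), of "\<lambda>_. 1"]
    by (simp add: norm_orthonormal_comb[OF assms])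
  then show ?thesis
    by (simp add: has_bochner_integral_iff nn_integral_eq_integral)
qed

lemma measurable_comb [measurable]:
  fixes B :: "'a::euclidean_space set"
  shows "(\<lambda>x. \<Sum>b\<in>B. x b *\<^sub>R b) \<in> borel_measurable (coord_measure B)"
  by measurable

text \<open>Translation invariance of Lebesgue measure, coordinate by coordinate; on product measures it is enough to
compare boxes.\<close>
lemma coord_measure_translate:
  fixes c :: "'b \<Rightarrow> real"
  assumes "finite B"
  shows "distr (coord_measure B) (coord_measure B) (\<lambda>x. \<lambda>b\<in>B. x b + c b) = coord_measure B"
proof -
  interpret product_sigma_finite "\<lambda>_::'b. lborel :: real measure"
    by standard
  show ?thesis
  proof (rule PiM_eqI[OF assms])
    fix A :: "'b \<Rightarrow> real set"
    assume A: "\<And>b. b \<in> B \<Longrightarrow> A b \<in> sets lborel"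
    let ?A' = "\<lambda>b. (\<lambda>t. t + c b) -` A b"
    have A': "?A' b \<in> sets lborel" if "b \<in> B" for b
      using A[OF that] measurable_sets[of "\<lambda>t. t + c b" lborel borel "A b"] by simp
    have vim: "(\<lambda>x. \<lambda>b\<in>B. x b + c b) -` Pi\<^sub>E B A \<inter> space (coord_measure B) = Pi\<^sub>E B ?A'"
      by (auto simp: space_PiM PiE_iff extensional_def)
    have "emeasure (distr (coord_measure B) (coord_measure B) (\<lambda>x. \<lambda>b\<in>B. x b + c b)) (Pi\<^sub>E B A)
        = emeasure (coord_measure B) (Pi\<^sub>E B ?A')"
      using A assms by (subst emeasure_distr) (auto simp: vim intro!: sets_PiM_I_finite)
    also have "\<dots> = (\<Prod>b\<in>B. emeasure lborel (?A' b))"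
      using A' assms by (intro emeasure_PiM) auto
    also have "\<dots> = (\<Prod>b\<in>B. emeasure lborel (A b))"
    proof (intro prod.cong refl)
      fix b assume "b \<in> B"
      then have "emeasure (distr lborel borel ((+) (c b))) (A b) = emeasure lborel ((+) (c b) -` A b)"
        using A by (subst emeasure_distr) auto
      moreover have "(+) (c b) -` A b = ?A' b"
        by (auto simp: add.commute)
      ultimately show "emeasure lborel (?A' b) = emeasure lborel (A b)"
        by (simp add: lborel_distr_plus)
    qed
    finally show "emeasure (distr (coord_measure B) (coord_measure B) (\<lambda>x. \<lambda>b\<in>B. x b + c b)) (Pi\<^sub>E B A)
        = (\<Prod>b\<in>B. emeasure lborel (A b))" .
  qed simp
qed

lemma nn_integral_frame_translate:
  fixes B :: "'a::euclidean_space set"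
  assumes "finite B" "f \<in> borel_measurable borel" "v \<in> span B"
  shows "(\<integral>\<^sup>+x. f (comb B x + v) \<partial>coord_measure B) = (\<integral>\<^sup>+x. f (comb B x) \<partial>coord_measure B)"
proof -
  obtain c where v: "v = comb B c"
    using assms(1,3) by (auto simp: span_finite)
  have "(\<integral>\<^sup>+x. f (comb B x) \<partial>coord_measure B)
      = (\<integral>\<^sup>+x. f (comb B x) \<partial>distr (coord_measure B) (coord_measure B) (\<lambda>x. \<lambda>b\<in>B. x b + c b))"
    by (simp add: coord_measure_translate[OF assms(1)])
  also have "\<dots> = (\<integral>\<^sup>+x. f (comb B (\<lambda>b\<in>B. x b + c b)) \<partial>coord_measure B)"
    using measurable_compose[OF measurable_comb assms(2)]
    by (intro nn_integral_distr) (simp_all, measurable)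
  also have "\<dots> = (\<integral>\<^sup>+x. f (comb B x + v) \<partial>coord_measure B)"
    by (simp add: v scaleR_left_distrib sum.distrib cong: sum.cong)
  finally show ?thesis ..
qed

lemma comb_in_span: "comb B x \<in> span B"
  by (intro span_sum span_scale span_base)

text \<open>Two frames \<open>B\<close>, \<open>B'\<close> of the same subspace give measures that are both invariant under translation along
that subspace. As in the uniqueness proof for Haar measure, with \<open>g\<close> an even function,
\<open>\<integral>f \<partial>B \<integral>g \<partial>B' = \<integral>\<integral>f(x) g(y - x) = \<integral>\<integral>f(x + y) g(x) = \<integral>f \<partial>B' \<integral>g \<partial>B\<close>, by Fubini's theorem and translation by \<open>x\<close> and \<open>y\<close>.
For a Gaussian \<open>g\<close> the two integrals of \<open>g\<close> agree and are finite and positive, so they cancel.\<close>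
lemma nn_integral_frame_unique:
  fixes B B' :: "'a::euclidean_space set"
  assumes B: "finite B" "pairwise orthogonal B" "\<And>b. b \<in> B \<Longrightarrow> norm b = 1"
    and B': "finite B'" "pairwise orthogonal B'" "\<And>b. b \<in> B' \<Longrightarrow> norm b = 1"
    and span: "span B = span B'"
    and f [measurable]: "f \<in> borel_measurable borel"
  shows "(\<integral>\<^sup>+x. f (comb B x) \<partial>coord_measure B) = (\<integral>\<^sup>+x. f (comb B' x) \<partial>coord_measure B')"
proof -
  interpret product_sigma_finite "\<lambda>_::'a. lborel :: real measure"
    by standard
  interpret PB: finite_product_sigma_finite "\<lambda>_::'a. lborel :: real measure" B
    by standard (rule B(1))
  interpret PB': finite_product_sigma_finite "\<lambda>_::'a. lborel :: real measure" B'
    by standard (rule B'(1))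
  interpret pair_sigma_finite "coord_measure B" "coord_measure B'"
    by standard
  define g :: "'a \<Rightarrow> ennreal" where "g = (\<lambda>y. ennreal (exp (- (norm y)\<^sup>2 / 2)))"
  have g [measurable]: "g \<in> borel_measurable borel"
    unfolding g_def by measurable
  have "0 \<notin> B" "0 \<notin> B'"
    using B(3)[of 0] B'(3)[of 0] by auto
  then have "independent B" "independent B'"
    using B(2) B'(2) pairwise_orthogonal_independent by blast+
  then have "card B = card B'"
    using span by (metis dim_span_eq_card_independent)
  then have gauss: "(\<integral>\<^sup>+y. g (comb B' y) \<partial>coord_measure B') = (\<integral>\<^sup>+x. g (comb B x) \<partial>coord_measure B)"
    using nn_integral_frame_gaussian[OF B] nn_integral_frame_gaussian[OF B'] by (simp add: g_def)
  have "(\<integral>\<^sup>+x. f (comb B x) \<partial>coord_measure B) * (\<integral>\<^sup>+y. g (comb B' y) \<partial>coord_measure B')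
      = (\<integral>\<^sup>+x. f (comb B x) * (\<integral>\<^sup>+y. g (comb B' y) \<partial>coord_measure B') \<partial>coord_measure B)"
    by (simp add: nn_integral_multc)
  also have "\<dots> = (\<integral>\<^sup>+x. f (comb B x) * (\<integral>\<^sup>+y. g (comb B' y + - comb B x) \<partial>coord_measure B') \<partial>coord_measure B)"
    by (subst nn_integral_frame_translate[OF B'(1) g])
       (auto simp: span[symmetric] intro!: span_neg comb_in_span)
  also have "\<dots> = (\<integral>\<^sup>+x. \<integral>\<^sup>+y. f (comb B x) * g (comb B' y + - comb B x) \<partial>coord_measure B' \<partial>coord_measure B)"
    by (simp add: nn_integral_cmult)
  also have "\<dots> = (\<integral>\<^sup>+y. \<integral>\<^sup>+x. f (comb B x) * g (comb B' y + - comb B x) \<partial>coord_measure B \<partial>coord_measure B')"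
    by (rule Fubini'[symmetric]) measurable
  also have "\<dots> = (\<integral>\<^sup>+y. \<integral>\<^sup>+x. f (comb B x + comb B' y) * g (comb B x) \<partial>coord_measure B \<partial>coord_measure B')"
  proof (rule nn_integral_cong)
    fix y :: "'a \<Rightarrow> real"
    have "(\<integral>\<^sup>+x. f (comb B x) * g (comb B' y + - comb B x) \<partial>coord_measure B)
        = (\<integral>\<^sup>+x. (\<lambda>z. f z * g (comb B' y + - z)) (comb B x + comb B' y) \<partial>coord_measure B)"
      by (subst nn_integral_frame_translate[OF B(1)]) (auto simp: span intro!: comb_in_span)
    then show "(\<integral>\<^sup>+x. f (comb B x) * g (comb B' y + - comb B x) \<partial>coord_measure B)
        = (\<integral>\<^sup>+x. f (comb B x + comb B' y) * g (comb B x) \<partial>coord_measure B)"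
      by (simp add: g_def)
  qed
  also have "\<dots> = (\<integral>\<^sup>+x. \<integral>\<^sup>+y. f (comb B x + comb B' y) * g (comb B x) \<partial>coord_measure B' \<partial>coord_measure B)"
    by (rule Fubini') measurable
  also have "\<dots> = (\<integral>\<^sup>+x. (\<integral>\<^sup>+y. f (comb B' y + comb B x) \<partial>coord_measure B') * g (comb B x) \<partial>coord_measure B)"
    by (simp add: nn_integral_multc add.commute)
  also have "\<dots> = (\<integral>\<^sup>+x. (\<integral>\<^sup>+y. f (comb B' y) \<partial>coord_measure B') * g (comb B x) \<partial>coord_measure B)"
    by (subst nn_integral_frame_translate[OF B'(1) f])
       (auto simp: span[symmetric] intro!: comb_in_span)
  also have "\<dots> = (\<integral>\<^sup>+y. f (comb B' y) \<partial>coord_measure B') * (\<integral>\<^sup>+y. g (comb B' y) \<partial>coord_measure B')"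
    by (simp add: nn_integral_cmult gauss)
  finally show ?thesis
    using nn_integral_frame_gaussian[OF B'] by (simp add: g_def mult.commute[of _ "ennreal _"] ennreal_mult_cancel_left)
qed

lemma affine_frameD:
  fixes S :: "'a::euclidean_space set"
  assumes "affine_frame S (a, B)"
  shows "finite B" "pairwise orthogonal B" "\<And>b. b \<in> B \<Longrightarrow> norm b = 1" "S = (+) a ` span B"
proof -
  show *: "pairwise orthogonal B" "\<And>b. b \<in> B \<Longrightarrow> norm b = 1" "S = (+) a ` span B"
    using assms by (auto simp: affine_frame_def)
  have "0 \<notin> B"
    using *(2) by force
  then show "finite B"
    using *(1) pairwise_orthogonal_imp_finite by blast
qed

lemma mem_translation_iff:
  fixes a :: "'a::ab_group_add"
  shows "z \<in> (+) a ` V \<longleftrightarrow> z - a \<in> V"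
  by (auto simp: image_iff intro!: bexI[of _ "z - a"])

text \<open>The choice operator in the definition may pick any frame. Two frames of the same affine subspace have
the same direction space, and their base points differ by a vector of it.\<close>
lemma surface_measure_eq:
  fixes S :: "'a::euclidean_space set"
  assumes frame: "affine_frame S (a, B)"
  shows "surface_measure S = distr (coord_measure B) borel (\<lambda>x. a + comb B x)"
proof -
  obtain a' B' where some: "(SOME aB. affine_frame S aB) = (a', B')"
    by (cases "SOME aB. affine_frame S aB")
  then have frame': "affine_frame S (a', B')"
    using someI[of "affine_frame S", OF frame] by simp
  note B = affine_frameD[OF frame] and B' = affine_frameD[OF frame']
  have S: "z \<in> S \<longleftrightarrow> z - a \<in> span B" "z \<in> S \<longleftrightarrow> z - a' \<in> span B'" for z
    using mem_translation_iff[of z a "span B"] mem_translation_iff[of z a' "span B'"] B(4) B'(4)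
    by simp_all
  have a: "a' - a \<in> span B" "a - a' \<in> span B'"
    using S(1)[of a'] S(2)[of a'] S(1)[of a] S(2)[of a] by (auto simp: span_zero)
  have span: "span B = span B'"
  proof (intro set_eqI iffI)
    fix v assume "v \<in> span B"
    then have "a + v - a' \<in> span B'" using S[of "a + v"] by simp
    from span_diff[OF this a(2)] show "v \<in> span B'" by (simp add: algebra_simps)
  next
    fix v assume "v \<in> span B'"
    then have "a' + v - a \<in> span B" using S[of "a' + v"] by simp
    from span_diff[OF this a(1)] show "v \<in> span B" by (simp add: algebra_simps)
  qed
  have "distr (coord_measure B') borel (\<lambda>x. a' + comb B' x) = distr (coord_measure B) borel (\<lambda>x. a + comb B x)"
  proof (rule measure_eqI)
    fix X assume "X \<in> sets (distr (coord_measure B') borel (\<lambda>x. a' + comb B' x))"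
    then have X [measurable]: "X \<in> sets borel"
      by simp
    have "emeasure (distr (coord_measure B') borel (\<lambda>x. a' + comb B' x)) X
        = (\<integral>\<^sup>+x. indicator X (a' + comb B' x) \<partial>coord_measure B')"
      by (subst nn_integral_indicator[symmetric], simp, subst nn_integral_distr) (simp_all, measurable)
    also have "\<dots> = (\<integral>\<^sup>+x. indicator X (a' + comb B x) \<partial>coord_measure B)"
      by (rule nn_integral_frame_unique[OF B'(1-3) B(1-3) span[symmetric]]) measurable
    also have "\<dots> = (\<integral>\<^sup>+x. indicator X (a + (comb B x + (a' - a))) \<partial>coord_measure B)"
      by (simp add: algebra_simps)
    also have "\<dots> = (\<integral>\<^sup>+x. indicator X (a + comb B x) \<partial>coord_measure B)"
      by (rule nn_integral_frame_translate[OF B(1) _ a(1), of "\<lambda>z. indicator X (a + z)"]) measurable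
    also have "\<dots> = emeasure (distr (coord_measure B) borel (\<lambda>x. a + comb B x)) X"
      by (subst nn_integral_indicator[symmetric], simp, subst nn_integral_distr) (simp_all, measurable)
    finally show "emeasure (distr (coord_measure B') borel (\<lambda>x. a' + comb B' x)) X
        = emeasure (distr (coord_measure B) borel (\<lambda>x. a + comb B x)) X" .
  qed simp
  then show ?thesis
    by (simp add: surface_measure_def some)
qed

lemma affine_frame_in_sets:
  fixes S :: "'a::euclidean_space set"
  assumes frame: "affine_frame S (a, B)"
  shows "S \<in> sets (surface_measure S)"
proof -
  have "closed S"
    unfolding affine_frameD(4)[OF frame] by (intro closed_translation closed_subspace subspace_span)
  then show ?thesis
    by (simp add: surface_measure_eq[OF frame])
qed

section \<open>Gaussian integrals over affine hyperplanes\<close>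

lemma bilinear_diagonal_comb:
  fixes B :: "'a::euclidean_space set"
  assumes "bilinear \<beta>" "finite B" and diag: "\<forall>b\<in>B. \<forall>b'\<in>B. b \<noteq> b' \<longrightarrow> \<beta> b b' = (0::real)"
  shows "\<beta> (comb B x) (comb B x) = (\<Sum>b\<in>B. \<beta> b b * (x b)\<^sup>2)"
proof -
  have "\<beta> (comb B x) (comb B x) = (\<Sum>b\<in>B. \<Sum>b'\<in>B. \<beta> (x b *\<^sub>R b) (x b' *\<^sub>R b'))"
    using bilinear_sum[OF assms(1)] by (simp add: sum.cartesian_product)
  also have "\<dots> = (\<Sum>b\<in>B. \<Sum>b'\<in>B. if b = b' then \<beta> b b * (x b)\<^sup>2 else 0)"
    using diag by (intro sum.cong refl)
      (auto simp: bilinear_lmul[OF assms(1)] bilinear_rmul[OF assms(1)] power2_eq_square)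
  finally show ?thesis
    using assms(2) by simp
qed

text \<open>In the coordinates of the frame the form is a positive combination of squares, so the integral
factorizes. On the whole space \<open>\<beta>\<close> may be indefinite, as it is at a saddle.\<close>
lemma surface_integral_gaussian:
  fixes S :: "'a::euclidean_space set"
  assumes frame: "affine_frame S (a, B)" and "bilinear \<beta>" and "\<epsilon> > 0"
    and diag: "\<forall>b\<in>B. \<forall>b'\<in>B. b \<noteq> b' \<longrightarrow> \<beta> b b' = 0"
    and pos: "\<forall>b\<in>B. \<beta> b b > 0"
  shows "(LINT z:S|surface_measure S. exp (- \<beta> (z - a) (z - a) / (2 * \<epsilon>)))
           = (\<Prod>b\<in>B. sqrt (2 * pi * \<epsilon> / \<beta> b b))"
proof -
  note B = affine_frameD[OF frame]
  have S [measurable]: "S \<in> sets borel"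
    using affine_frame_in_sets[OF frame] by (simp add: surface_measure_eq[OF frame])
  have "continuous_on UNIV (\<lambda>z. \<beta> (z - a) (z - a))"
    using assms(2) unfolding bilinear_conv_bounded_bilinear
    by (rule bounded_bilinear.continuous_on) (intro continuous_intros)+
  then have [measurable]: "(\<lambda>z. \<beta> (z - a) (z - a)) \<in> borel_measurable borel"
    by (rule borel_measurable_continuous_onI)
  have in_S: "a + comb B x \<in> S" for x
    unfolding B(4) by (intro imageI comb_in_span)
  have "(LINT z:S|surface_measure S. exp (- \<beta> (z - a) (z - a) / (2 * \<epsilon>)))
      = (LINT x|coord_measure B. indicator S (a + comb B x) *\<^sub>R
           exp (- \<beta> (a + comb B x - a) (a + comb B x - a) / (2 * \<epsilon>)))"
    unfolding surface_measure_eq[OF frame] set_lebesgue_integral_def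
    by (rule integral_distr) measurable
  also have "\<dots> = (LINT x|coord_measure B. exp (- (\<Sum>b\<in>B. \<beta> b b / \<epsilon> * (x b)\<^sup>2) / 2))"
    by (simp add: in_S bilinear_diagonal_comb[OF assms(2) B(1) diag] sum_divide_distrib mult.commute)
  also have "\<dots> = (\<Prod>b\<in>B. sqrt (2 * pi / (\<beta> b b / \<epsilon>)))"
    using has_bochner_integral_diagonal_gaussian[OF B(1), of "\<lambda>b. \<beta> b b / \<epsilon>"] pos \<open>\<epsilon> > 0\<close>
    by (simp add: has_bochner_integral_iff)
  finally show ?thesis
    by simp
qed

abbreviation orthonormal_family :: "'i set \<Rightarrow> ('i \<Rightarrow> 'a::real_inner) \<Rightarrow> bool" where
  "orthonormal_family I F \<equiv> \<forall>i\<in>I. \<forall>j\<in>I. F i \<bullet> F j = (if i = j then 1 else 0)"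

text \<open>An orthonormal family of tangent vectors with one element less than the dimension spans the hyperplane, so
it suffices to count.\<close>
lemma affine_frame_hyperplane:
  fixes N a :: "'a::euclidean_space" and F :: "'i \<Rightarrow> 'a"
  assumes orth: "orthonormal_family I F"
    and normal: "\<forall>i\<in>I. N \<bullet> F i = 0"
    and "N \<noteq> 0" "finite I" "card I = DIM('a) - 1"
  shows "inj_on F I" "affine_frame {z. (z - a) \<bullet> N = 0} (a, F ` I)"
proof -
  show inj: "inj_on F I"
    using orth by (intro inj_onI) (metis zero_neq_one)
  have pairwise: "pairwise orthogonal (F ` I)"
    using orth by (auto simp: pairwise_def orthogonal_def)
  have unit: "norm b = 1" if "b \<in> F ` I" for b
    using that orth by (auto simp: norm_eq_1)
  then have "0 \<notin> F ` I"
    by fastforce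
  then have "independent (F ` I)"
    using pairwise pairwise_orthogonal_independent by blast
  then have "dim (span (F ` I)) = DIM('a) - 1"
    using inj assms(5) by (simp add: dim_eq_card_independent card_image)
  then have "span (F ` I) = {x. N \<bullet> x = 0}"
    using normal \<open>N \<noteq> 0\<close>
    by (intro subspace_dim_equal subspace_span subspace_hyperplane span_minimal)
       (auto simp: dim_hyperplane)
  then have "{z. (z - a) \<bullet> N = 0} = (+) a ` span (F ` I)"
    by (simp add: set_eq_iff mem_translation_iff inner_commute)
  then show "affine_frame {z. (z - a) \<bullet> N = 0} (a, F ` I)"
    using pairwise unit by (auto simp: affine_frame_def)
qed

section \<open>Gradients, the cubic equation and tail integrals\<close>

lemma grad_eqI: "GDERIV f x :> D \<Longrightarrow> grad f x = D"
  unfolding grad_def gderiv_def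
proof (rule the_equality)
  fix D' assume "(f has_derivative (\<lambda>h. h \<bullet> D)) (at x)" "(f has_derivative (\<lambda>h. h \<bullet> D')) (at x)"
  then have "(\<lambda>h. h \<bullet> D') = (\<lambda>h. h \<bullet> D)"
    by (rule has_derivative_unique[symmetric])
  then have "h \<bullet> (D' - D) = 0" for h
    by (metis inner_diff_right right_minus_eq)
  then show "D' = D"
    by (metis inner_eq_zero_iff right_minus_eq)
qed

text \<open>The cubic equals \<open>(\<mu> + \<gamma>) (\<mu>\<^sup>2 + \<gamma>\<^sup>2 \<mu> / (\<mu> + \<gamma>) - l / L)\<close>, and the function of \<open>\<mu>\<close> in the second factor is strictly
increasing on the positive half-line. This gives uniqueness, so the definite description denotes the
positive root, and the factored equation is the form in which the root is used later.\<close>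
lemma mu_sigma:
  fixes L \<gamma> l :: real
  assumes "L > 0" "\<gamma> > 0" "l > 0"
  defines "\<mu> \<equiv> mu_sigma L \<gamma> l"
  shows "\<mu> > 0" "l / L = \<mu>\<^sup>2 + \<gamma>\<^sup>2 * \<mu> / (\<mu> + \<gamma>)"
proof -
  let ?P = "\<lambda>\<mu>. \<mu>^3 + \<gamma> * \<mu>^2 + (\<gamma>^2 - l / L) * \<mu> - \<gamma> * l / L"
  let ?h = "\<lambda>\<mu>. \<mu>\<^sup>2 + \<gamma>\<^sup>2 * \<mu> / (\<mu> + \<gamma>)"
  have factor: "?P x = (x + \<gamma>) * (?h x - l / L)" if "x > 0" for x
  proof -
    have "x^3 + \<gamma> * x^2 + (\<gamma>^2 - k) * x - \<gamma> * k = (x + \<gamma>) * (?h x - k)" for k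
      using that \<open>\<gamma> > 0\<close> by (simp add: field_simps power2_eq_square power3_eq_cube)
    from this[of "l / L"] show ?thesis by simp
  qed
  have root: "?P x = 0 \<longleftrightarrow> l / L = ?h x" if "x > 0" for x
    using factor[OF that] that \<open>\<gamma> > 0\<close> by auto
  have mono: "?h x < ?h y" if "0 < x" "x < y" for x y
  proof -
    have "\<gamma>\<^sup>2 * x / (x + \<gamma>) < \<gamma>\<^sup>2 * y / (y + \<gamma>)"
      using that \<open>\<gamma> > 0\<close> by (simp add: field_simps)
    moreover have "x\<^sup>2 < y\<^sup>2"
      using that by (intro power_strict_mono) auto
    ultimately show ?thesis by simp
  qed
  let ?M = "sqrt (l / L)"
  have M: "?M > 0" "?M\<^sup>2 = l / L"
    using assms by auto
  have "\<exists>x\<ge>0. x \<le> ?M \<and> ?P x = 0"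
  proof (rule IVT')
    have "?M + \<gamma> \<noteq> 0"
      using M(1) \<open>\<gamma> > 0\<close> by linarith
    then have "(?M + \<gamma>) * (?h ?M - l / L) = \<gamma>\<^sup>2 * ?M"
      unfolding M(2) by simp
    with factor[OF M(1)] have "?P ?M = \<gamma>\<^sup>2 * ?M"
      by (rule trans)
    then show "0 \<le> ?P ?M" using M by simp
    show "?P 0 \<le> 0" using assms by simp
  qed (use M in \<open>auto intro!: continuous_intros\<close>)
  then obtain x where x: "x \<ge> 0" "?P x = 0" by blast
  moreover have "?P 0 \<noteq> 0" using assms by simp
  ultimately have "x > 0" by (metis order_le_less)
  have "\<exists>!x. x > 0 \<and> ?P x = 0"
  proof (rule ex1I[of _ x])
    fix y assume y: "y > 0 \<and> ?P y = 0"
    then show "y = x"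
      using root[of y] root[of x] mono[of x y] mono[of y x] x \<open>x > 0\<close>
      by (metis less_irrefl linorder_neqE_linordered_idom)
  qed (use x \<open>x > 0\<close> in simp)
  from theI'[OF this] have "\<mu> > 0 \<and> ?P \<mu> = 0"
    unfolding \<mu>_def mu_sigma_def .
  then show "\<mu> > 0" "l / L = ?h \<mu>"
    using root by auto
qed

text \<open>\<^term>\<open>Phi_sigma\<close> is an upper tail integral up to normalization; subtracting the integral over a bounded
interval reduces its derivative to the fundamental theorem of calculus.\<close>
lemma DERIV_upper_tail:
  fixes g :: "real \<Rightarrow> real"
  assumes int: "integrable lborel g" and cont: "continuous_on UNIV g"
  shows "((\<lambda>x. LINT y:{x..}|lborel. g y) has_real_derivative - g x) (at x)"
proof -
  have tail: "(LINT y:{t..}|lborel. g y) = (LINT y:{x - 1..}|lborel. g y) - (LBINT y=x - 1..t. g y)" for t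
  proof -
    have closed_open: "(LINT y:{s..}|lborel. g y) = (LBINT y=s..\<infinity>. g y)" for s
    proof -
      have "(LINT y:{s..}|lborel. g y) = (LINT y:{s<..}|lborel. g y)"
      proof (rule set_integral_cong_set)
        show "AE y in lborel. (y \<in> {s<..}) = (y \<in> {s..})"
          using AE_lborel_singleton[of s] by eventually_elim auto
      qed (use int in \<open>auto simp: set_borel_measurable_def\<close>)
      then show ?thesis
        by (simp add: interval_integral_to_infinity_eq)
    qed
    have "interval_lebesgue_integrable lborel (min (ereal (x - 1)) (min (ereal t) \<infinity>))
            (max (ereal (x - 1)) (max (ereal t) \<infinity>)) g"
      using integrable_mult_indicator[OF _ int]
      by (simp add: interval_lebesgue_integrable_def set_integrable_def)
    then have "(LBINT y=x - 1..t. g y) + (LBINT y=t..\<infinity>. g y) = (LBINT y=x - 1..\<infinity>. g y)"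
      by (rule interval_integral_sum)
    then show ?thesis
      by (simp add: closed_open)
  qed
  have "((\<lambda>t. LBINT y=x - 1..t. g y) has_vector_derivative g x) (at x within {x - 1..x + 1})"
    using cont by (intro interval_integral_FTC2) (auto intro: continuous_on_subset)
  then have "((\<lambda>t. LBINT y=x - 1..t. g y) has_real_derivative g x) (at x)"
    by (simp add: has_real_derivative_iff_has_vector_derivative at_within_Icc_at)
  then show ?thesis
    by (subst tail[THEN ext]) (auto intro!: derivative_eq_intros)
qed

section \<open>The quadratic Hamiltonian and the saddle hyperplane\<close>

text \<open>Each eigenvector \<open>v\<close> of the Hessian spans a copy of \<open>\<real>\<^sup>3\<close> in phase space, one dimension for each of
\<open>\<theta>\<close>, \<open>p\<close> and \<open>r\<close>. These copies are mutually orthogonal, both for the inner product and for the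
quadratic form below, so all computations reduce to \<open>\<real>\<^sup>3\<close>.\<close>
definition along :: "real^'n \<Rightarrow> real \<times> real \<times> real \<Rightarrow> 'n phase" where
  "along v = (\<lambda>(a, b, c). (a *\<^sub>R v, b *\<^sub>R v, c *\<^sub>R v))"

lemma inner_along: "along v t \<bullet> along w t' = (v \<bullet> w) * (t \<bullet> t')"
  by (cases t, cases t') (simp add: along_def algebra_simps)

text \<open>Twice the quadratic part of \<^term>\<open>quad_hamiltonian\<close>, as a bilinear form. Unlike \<open>lam\<close> there, \<open>D\<close> also has the
negative eigenvalue, at index 1.\<close>
definition saddle_form :: "real \<Rightarrow> (nat \<Rightarrow> real) \<Rightarrow> (nat \<Rightarrow> real^'n) \<Rightarrow> 'n phase \<Rightarrow> 'n phase \<Rightarrow> real" where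
  "saddle_form L D e = (\<lambda>(q, v, w) (q', v', w'). \<Sum>i=1..CARD('n).
     D i * (q \<bullet> e i) * (q' \<bullet> e i) + L * (v \<bullet> e i) * (v' \<bullet> e i) + L * (w \<bullet> e i) * (w' \<bullet> e i))"

lemma bilinear_saddle_form: "bilinear (saddle_form L D e)"
  unfolding bilinear_def
  by (auto simp: saddle_form_def split_beta inner_add_left sum.distrib sum_distrib_left algebra_simps
      intro!: linearI)

lemma saddle_form_along:
  fixes e :: "nat \<Rightarrow> real^'n"
  assumes orth: "orthonormal_family {1..CARD('n)} e"
    and ij: "i \<in> {1..CARD('n)}" "j \<in> {1..CARD('n)}"
  shows "saddle_form L D e (along (e i) (a, b, c)) (along (e j) (a', b', c'))
           = (if i = j then D i * a * a' + L * b * b' + L * c * c' else 0)"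
proof -
  have "saddle_form L D e (along (e i) (a, b, c)) (along (e j) (a', b', c'))
      = (\<Sum>k=1..CARD('n). if k = i then if i = j then D i * a * a' + L * b * b' + L * c * c' else 0 else 0)"
    unfolding saddle_form_def along_def prod.case using orth ij by (intro sum.cong refl) auto
  then show ?thesis
    using ij by simp
qed

lemma quad_hamiltonian_eq:
  fixes e :: "nat \<Rightarrow> real^'n"
  shows "quad_hamiltonian U L \<sigma> l lam e z
    = U \<sigma> + saddle_form L (lam(1 := - l)) e (z - (\<sigma>, 0, 0)) (z - (\<sigma>, 0, 0)) / 2"
proof -
  obtain \<theta> p r where z: "z = (\<theta>, p, r)"
    by (cases z)
  have split: "(\<Sum>i=1..CARD('n). f i) = f 1 + (\<Sum>i=2..CARD('n). f i)" for f :: "nat \<Rightarrow> real"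
    using sum.atLeast_Suc_atMost[of 1 "CARD('n)" f] by (simp add: numeral_2_eq_2)
  have "(\<Sum>i=2..CARD('n). (lam(1 := - l)) i * ((\<theta> - \<sigma>) \<bullet> e i) * ((\<theta> - \<sigma>) \<bullet> e i))
      = (\<Sum>i=2..CARD('n). lam i * ((\<theta> - \<sigma>) \<bullet> e i)\<^sup>2)"
    by (intro sum.cong) (auto simp: power2_eq_square)
  then have quadratic: "(\<Sum>i=1..CARD('n). (lam(1 := - l)) i * ((\<theta> - \<sigma>) \<bullet> e i) * ((\<theta> - \<sigma>) \<bullet> e i))
      = - l * ((\<theta> - \<sigma>) \<bullet> e 1)\<^sup>2 + (\<Sum>i=2..CARD('n). lam i * ((\<theta> - \<sigma>) \<bullet> e i)\<^sup>2)"
    by (subst split) (simp add: power2_eq_square)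
  have "saddle_form L (lam(1 := - l)) e (\<theta> - \<sigma>, p, r) (\<theta> - \<sigma>, p, r)
      = - l * ((\<theta> - \<sigma>) \<bullet> e 1)\<^sup>2 + (\<Sum>i=2..CARD('n). lam i * ((\<theta> - \<sigma>) \<bullet> e i)\<^sup>2)
        + L * (\<Sum>i=1..CARD('n). (p \<bullet> e i)\<^sup>2) + L * (\<Sum>i=1..CARD('n). (r \<bullet> e i)\<^sup>2)"
    unfolding quadratic[symmetric] saddle_form_def prod.case sum.distrib sum_distrib_left
    by (simp only: power2_eq_square mult.assoc)
  moreover have "u - l / 2 * x + 1 / 2 * y + L / 2 * v + L / 2 * w = u + (- l * x + y + L * v + L * w) / 2"
    for u x y v w :: real
    by (simp add: field_simps)
  ultimately show ?thesis
    unfolding z quad_hamiltonian_def Let_def by simp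
qed

lemma Lambda_sigma_eq:
  "Lambda_sigma L \<gamma> \<sigma> l v z
     = (z - (\<sigma>, 0, 0)) \<bullet> along v (alpha_sigma L \<gamma> l, 1, zeta_sigma L \<gamma> l)"
  by (cases z) (simp add: Lambda_sigma_def along_def)

lemma GDERIV_Lambda_sigma:
  "GDERIV (Lambda_sigma L \<gamma> \<sigma> l v) z :> along v (alpha_sigma L \<gamma> l, 1, zeta_sigma L \<gamma> l)"
  unfolding gderiv_def Lambda_sigma_eq[abs_def] by (auto intro!: derivative_eq_intros)

lemma M_op_scaleR: "M_op L \<gamma> (k *\<^sub>R z) = k *\<^sub>R M_op L \<gamma> z"
  by (cases z) (simp add: M_op_def algebra_simps)

text \<open>The antisymmetric part of the matrix drops out, so only friction in the \<open>r\<close>-direction contributes to the flux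
through the hyperplane.\<close>
lemma M_op_inner_self: "M_op L \<gamma> (a, b, c) \<bullet> (a, b, c) = \<gamma> / L * (c \<bullet> c)"
  by (simp add: M_op_def inner_commute algebra_simps)

section \<open>The current through the saddle hyperplane\<close>

locale saddle_parameters =
  fixes L \<gamma> l :: real
  assumes pos: "L > 0" "\<gamma> > 0" "l > 0"
begin

abbreviation "\<mu> \<equiv> mu_sigma L \<gamma> l"
abbreviation "\<alpha> \<equiv> alpha_sigma L \<gamma> l"
abbreviation "\<zeta> \<equiv> zeta_sigma L \<gamma> l"
abbreviation "c \<equiv> c_sigma L \<gamma> l"

lemma saddle_constants_pos: "\<mu> > 0" "\<alpha> > 0" "\<zeta> > 0" "c > 0"
  using pos mu_sigma(1)[OF pos] by (simp_all add: alpha_sigma_def zeta_sigma_def c_sigma_def add_pos_pos)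

text \<open>The left-hand side is the quadratic form on the \<open>\<real>\<^sup>3\<close> of the unstable direction, evaluated at a tangent
vector of the saddle hyperplane (the vector \<open>t2\<close> below, up to scaling). Its positivity is what makes the
Gaussian integrable on the hyperplane although the form is indefinite; the value comes from the
equation for \<open>\<mu>\<close>.\<close>
lemma saddle_constants_identity: "L * \<alpha>\<^sup>2 - l * (1 + \<zeta>\<^sup>2) = L * l * c / \<mu>"
proof -
  note \<mu> = mu_sigma[OF pos]
  have "l / L = \<mu>\<^sup>2 * (1 + \<zeta>\<^sup>2) + \<mu> * (L * c)"
    unfolding \<mu>(2) zeta_sigma_def c_sigma_def using \<mu>(1) pos
    by (simp add: divide_simps add_pos_pos) (simp add: algebra_simps power2_eq_square)
  then have "l / L / \<mu>\<^sup>2 = 1 + \<zeta>\<^sup>2 + L * c / \<mu>"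
    using \<mu>(1) by (simp add: add_divide_distrib power2_eq_square)
  moreover have "L * \<alpha>\<^sup>2 = l * (l / L / \<mu>\<^sup>2)"
    using pos by (simp add: alpha_sigma_def field_simps power2_eq_square)
  ultimately show ?thesis
    by (simp add: algebra_simps)
qed

lemma DERIV_Phi_sigma_0: "(Phi_sigma L \<gamma> l has_real_derivative - sqrt (\<mu> / (2 * pi * c))) (at 0)"
proof -
  let ?g = "\<lambda>y. exp (- \<mu> * y\<^sup>2 / (2 * c))"
  have gauss: "has_bochner_integral lborel ?g (sqrt (2 * pi * c / \<mu>))"
    using has_bochner_integral_gaussian[of "\<mu> / c"] saddle_constants_pos by (simp add: mult.commute[of 2])
  have "((\<lambda>x. LINT y:{x..}|lborel. ?g y) has_real_derivative - ?g 0) (at 0)"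
    using gauss by (intro DERIV_upper_tail) (auto simp: has_bochner_integral_iff intro!: continuous_intros)
  then have "(Phi_sigma L \<gamma> l has_real_derivative - ?g 0 / (LINT y|lborel. ?g y)) (at 0)"
    unfolding Phi_sigma_def[abs_def] by (rule DERIV_cdivide)
  moreover have "(LINT y|lborel. ?g y) = sqrt (2 * pi * c / \<mu>)"
    using gauss by (simp add: has_bochner_integral_iff)
  ultimately show ?thesis
    by (simp add: real_sqrt_divide)
qed

lemma grad_psi_eps:
  assumes "Lambda_sigma L \<gamma> \<sigma> l v z = 0"
  shows "grad (psi_eps L \<gamma> \<sigma> l v \<epsilon>) z = (- sqrt (\<mu> / (2 * pi * c)) / sqrt \<epsilon>) *\<^sub>R along v (\<alpha>, 1, \<zeta>)"
proof -
  have "((\<lambda>t. Phi_sigma L \<gamma> l (t / sqrt \<epsilon>)) has_real_derivative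
      - sqrt (\<mu> / (2 * pi * c)) * (1 / sqrt \<epsilon>)) (at 0)"
    using DERIV_Phi_sigma_0
    by (intro DERIV_chain2[where g = "\<lambda>t. t / sqrt \<epsilon>"] DERIV_cdivide DERIV_ident) simp
  then have "GDERIV (\<lambda>z. Phi_sigma L \<gamma> l (Lambda_sigma L \<gamma> \<sigma> l v z / sqrt \<epsilon>)) z
      :> (- sqrt (\<mu> / (2 * pi * c)) * (1 / sqrt \<epsilon>)) *\<^sub>R along v (\<alpha>, 1, \<zeta>)"
    using assms by (intro GDERIV_DERIV_compose[OF GDERIV_Lambda_sigma]) simp
  then show ?thesis
    by (simp add: psi_eps_def[abs_def] grad_eqI)
qed

text \<open>On the hyperplane the current density is constant apart from the Gaussian factor, because \<open>\<psi>\<close> is a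
function of \<^term>\<open>Lambda_sigma\<close>, an affine function that vanishes there.\<close>
lemma current_density:
  assumes "Lambda_sigma L \<gamma> \<sigma> l v z = 0" and "norm v = 1"
  shows "M_op L \<gamma> (grad (psi_eps L \<gamma> \<sigma> l v \<epsilon>) z) \<bullet> n_sigma L \<gamma> \<sigma> l v z
    = - sqrt (\<mu> / (2 * pi * c)) / sqrt \<epsilon> * c / sqrt (\<alpha>\<^sup>2 + 1 + \<zeta>\<^sup>2)"
proof -
  have "v \<bullet> v = 1"
    using assms(2) by (simp add: norm_eq_1)
  then have "M_op L \<gamma> (along v (\<alpha>, 1, \<zeta>)) \<bullet> along v (\<alpha>, 1, \<zeta>) = c"
    by (simp add: along_def M_op_inner_self c_sigma_def power2_eq_square)
  moreover have "norm (along v (\<alpha>, 1, \<zeta>)) = sqrt (\<alpha>\<^sup>2 + 1 + \<zeta>\<^sup>2)"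
    using \<open>v \<bullet> v = 1\<close> by (simp add: norm_eq_sqrt_inner inner_along power2_eq_square algebra_simps)
  ultimately show ?thesis
    unfolding grad_psi_eps[OF assms(1)] n_sigma_def grad_eqI[OF GDERIV_Lambda_sigma] M_op_scaleR
      inner_scaleR_left inner_scaleR_right
    by simp
qed

text \<open>The hyperplane has an orthonormal frame that also diagonalizes the quadratic form. For each stable
eigenvector it contains the three coordinate directions of the corresponding \<open>\<real>\<^sup>3\<close>; in the \<open>\<real>\<^sup>3\<close> of the
unstable one it contains two vectors \<open>t1\<close>, \<open>t2\<close> spanning the plane orthogonal to \<open>(\<alpha>, 1, \<zeta>)\<close>. Each vector of
the frame contributes a one-dimensional Gaussian integral.\<close>
lemma saddle_surface_integral:
  fixes e :: "nat \<Rightarrow> real^'n" and \<sigma> :: "real^'n"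
  assumes orth: "orthonormal_family {1..CARD('n)} e"
    and lam: "\<forall>i\<in>{2..CARD('n)}. lam i > 0" and "\<epsilon> > 0"
  defines "S \<equiv> Sigma_lin L \<gamma> \<sigma> l (e 1)" and "K \<equiv> 2 * pi * \<epsilon>"
  shows "S \<in> sets (surface_measure S)"
    and "(LINT z:S|surface_measure S. exp (- quad_hamiltonian U L \<sigma> l lam e z / \<epsilon>))
      = exp (- U \<sigma> / \<epsilon>) * (\<Prod>i=2..CARD('n). sqrt (K / lam i) * (K / L))
          * (K / L * sqrt (\<mu> / (l * c)) * sqrt (\<alpha>\<^sup>2 + 1 + \<zeta>\<^sup>2))"
proof -
  let ?d = "CARD('n)"
  define D where "D = lam(1 := - l)"
  have D: "D 1 = - l" "\<And>i. i \<in> {2..?d} \<Longrightarrow> D i = lam i"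
    by (auto simp: D_def)
  let ?\<beta> = "saddle_form L D e"
  let ?N = "along (e 1) (\<alpha>, 1, \<zeta>)"
  define s where "s = sqrt (1 + \<zeta>\<^sup>2)"
  define n where "n = sqrt (\<alpha>\<^sup>2 + 1 + \<zeta>\<^sup>2)"
  have s: "s > 0" "s\<^sup>2 = 1 + \<zeta>\<^sup>2" and n: "n > 0" "n\<^sup>2 = \<alpha>\<^sup>2 + 1 + \<zeta>\<^sup>2"
    by (auto simp: s_def n_def add_nonneg_pos add_pos_nonneg intro: add_nonneg_nonneg)
  \<comment> \<open>On the \<open>\<real>\<^sup>3\<close> of the unstable direction the form is \<open>- l a\<^sup>2 + L (b\<^sup>2 + k\<^sup>2)\<close>. As the first entry of \<open>t1\<close> is 0,
    orthogonality to \<open>t1\<close> means the same for the form and for the inner product. So \<open>t2\<close> can be the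
    normalized cross product of \<open>t1\<close> and \<open>(\<alpha>, 1, \<zeta>)\<close>.\<close>
  define t1 :: "real \<times> real \<times> real" where "t1 = (0, - \<zeta> / s, 1 / s)"
  define t2 :: "real \<times> real \<times> real" where "t2 = (- s / n, \<alpha> / (s * n), \<alpha> * \<zeta> / (s * n))"
  define E :: "(real \<times> real \<times> real) set" where "E = {(1, 0, 0), (0, 1, 0), (0, 0, 1)}"
  define T where "T = (\<lambda>i::nat. if i = 1 then {t1, t2} else E)"
  define I where "I = (SIGMA i:{1..?d}. T i)"
  define F where "F = (\<lambda>(i, t). along (e i) t)"
  have t: "t1 \<bullet> t1 = 1" "t2 \<bullet> t2 = 1" "t1 \<bullet> t2 = 0" "t2 \<bullet> t1 = 0"
    "(\<alpha>, 1, \<zeta>) \<bullet> t1 = 0" "(\<alpha>, 1, \<zeta>) \<bullet> t2 = 0"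
  proof -
    show "t1 \<bullet> t1 = 1"
    proof -
      have "t1 \<bullet> t1 = (1 + \<zeta>\<^sup>2) / s\<^sup>2"
        by (simp add: t1_def power2_eq_square add_divide_distrib)
      then show ?thesis
        using s(1) by (simp add: s(2)[symmetric])
    qed
    have "t2 \<bullet> t2 = (s\<^sup>2 * s\<^sup>2 + \<alpha>\<^sup>2 * (1 + \<zeta>\<^sup>2)) / (s\<^sup>2 * n\<^sup>2)"
      using s(1) n(1) by (simp add: t2_def field_simps power2_eq_square)
    also have "\<dots> = (s\<^sup>2 + \<alpha>\<^sup>2) / n\<^sup>2"
      using s(1) n(1) unfolding s(2)[symmetric] by (simp add: field_simps power2_eq_square)
    also have "s\<^sup>2 + \<alpha>\<^sup>2 = n\<^sup>2"
      by (simp add: s(2) n(2))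
    finally show "t2 \<bullet> t2 = 1"
      using n(1) by simp
    show "t1 \<bullet> t2 = 0" "t2 \<bullet> t1 = 0"
      by (simp_all add: t1_def t2_def)
    show "(\<alpha>, 1, \<zeta>) \<bullet> t1 = 0"
      by (simp add: t1_def)
    have "(\<alpha>, 1, \<zeta>) \<bullet> t2 = \<alpha> * (1 + \<zeta>\<^sup>2 - s\<^sup>2) / (s * n)"
      using s(1) n(1) by (simp add: t2_def field_simps power2_eq_square)
    then show "(\<alpha>, 1, \<zeta>) \<bullet> t2 = 0"
      by (simp add: s(2))
  qed
  then have "t1 \<noteq> t2"
    by auto
  have T: "finite (T i)" "orthonormal_family (T i) (\<lambda>t. t)" for i
    using t \<open>t1 \<noteq> t2\<close> by (auto simp: T_def E_def)
  have one: "1 \<in> {1..?d}"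
    by (simp add: Suc_leI)
  then have range: "{1..?d} = insert 1 {2..?d}"
    by auto
  have "finite I"
    unfolding I_def using T(1) by (intro finite_SigmaI) auto
  have orthF: "orthonormal_family I F"
  proof (intro ballI)
    fix x y assume "x \<in> I" "y \<in> I"
    then obtain i u j v where xy: "x = (i, u)" "y = (j, v)"
      and ij: "i \<in> {1..?d}" "j \<in> {1..?d}" and uv: "u \<in> T i" "v \<in> T j"
      unfolding I_def by blast
    have "F x \<bullet> F y = (if i = j then u \<bullet> v else 0)"
      using orth ij by (simp add: xy F_def inner_along)
    also have "\<dots> = (if x = y then 1 else 0)"
      using T(2) uv by (simp add: xy)
    finally show "F x \<bullet> F y = (if x = y then 1 else 0)" .
  qed
  have normal: "\<forall>x\<in>I. ?N \<bullet> F x = 0"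
  proof
    fix x assume "x \<in> I"
    then obtain i u where x: "x = (i, u)" "i \<in> {1..?d}" "u \<in> T i"
      unfolding I_def by blast
    have "?N \<bullet> F x = (if i = 1 then (\<alpha>, 1, \<zeta>) \<bullet> u else 0)"
      using orth one x by (simp add: F_def inner_along)
    also have "\<dots> = 0"
      using x(3) t(5,6) by (simp add: T_def split: if_splits) blast
    finally show "?N \<bullet> F x = 0" .
  qed
  have "e 1 \<bullet> e 1 = 1"
    using orth one by auto
  then have "?N \<noteq> 0"
    by (auto simp: along_def zero_prod_def)
  have "card I = (\<Sum>i\<in>{1..?d}. card (T i))"
    unfolding I_def using T(1) by (intro card_SigmaI) auto
  also have "\<dots> = card {t1, t2} + (\<Sum>i=2..?d. card E)"
    unfolding range by (subst sum.insert) (auto simp: T_def)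
  also have "\<dots> = 2 + 3 * (?d - 1)"
  proof -
    have "card E = 3"
      by (simp add: E_def)
    then show ?thesis
      using \<open>t1 \<noteq> t2\<close> by simp
  qed
  finally have "card I = 3 * (?d - 1) + 2"
    by simp
  moreover have "DIM('n phase) = 3 * ?d" "?d > 0"
    by simp_all
  ultimately have card_I: "card I = DIM('n phase) - 1"
    by arith
  have S: "S = {z. (z - (\<sigma>, 0, 0)) \<bullet> ?N = 0}"
    by (simp add: S_def Sigma_lin_def Lambda_sigma_eq)
  have inj: "inj_on F I" and frame: "affine_frame S ((\<sigma>, 0, 0), F ` I)"
    unfolding S
    using affine_frame_hyperplane[OF orthF normal \<open>?N \<noteq> 0\<close> \<open>finite I\<close> card_I] by blast+
  show "S \<in> sets (surface_measure S)"
    by (rule affine_frame_in_sets[OF frame])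
  have \<beta>F: "?\<beta> (F (i, (a, b, k))) (F (j, (a', b', k')))
      = (if i = j then D i * a * a' + L * b * b' + L * k * k' else 0)"
    if "i \<in> {1..?d}" "j \<in> {1..?d}" for i j a b k a' b' k'
    unfolding F_def prod.case by (rule saddle_form_along[OF orth that])
  have \<beta>E: "?\<beta> (F (i, (1, 0, 0))) (F (i, (1, 0, 0))) = lam i" "?\<beta> (F (i, (0, 1, 0))) (F (i, (0, 1, 0))) = L"
     "?\<beta> (F (i, (0, 0, 1))) (F (i, (0, 0, 1))) = L" if "i \<in> {2..?d}" for i
    using that D(2) by (simp_all add: \<beta>F)
  have \<beta>1: "?\<beta> (F (1, t1)) (F (1, t1)) = L"
  proof -
    have "?\<beta> (F (1, t1)) (F (1, t1)) = L * ((1 + \<zeta>\<^sup>2) / s\<^sup>2)"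
      unfolding t1_def \<beta>F[OF one one] using s(1) by (simp add: field_simps power2_eq_square)
    then show ?thesis
      using s(1) by (simp add: s(2)[symmetric])
  qed
  have \<beta>2: "?\<beta> (F (1, t2)) (F (1, t2)) = L * l * c / (\<mu> * n\<^sup>2)"
  proof -
    have "?\<beta> (F (1, t2)) (F (1, t2)) = (L * \<alpha>\<^sup>2 * (1 + \<zeta>\<^sup>2) / s\<^sup>2 - l * s\<^sup>2) / n\<^sup>2"
      unfolding t2_def \<beta>F[OF one one] D(1) using s(1) n(1) by (simp add: field_simps power2_eq_square)
    also have "\<dots> = (L * \<alpha>\<^sup>2 - l * (1 + \<zeta>\<^sup>2)) / n\<^sup>2"
      using s by (simp add: s(2)[symmetric])
    finally show ?thesis
      by (simp add: saddle_constants_identity)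
  qed
  have \<beta>12: "?\<beta> (F (1, t1)) (F (1, t2)) = 0" "?\<beta> (F (1, t2)) (F (1, t1)) = 0"
    unfolding t1_def t2_def \<beta>F[OF one one] by simp_all
  have diag: "\<forall>b\<in>F ` I. \<forall>b'\<in>F ` I. b \<noteq> b' \<longrightarrow> ?\<beta> b b' = 0"
  proof (intro ballI impI)
    fix b b' assume "b \<in> F ` I" "b' \<in> F ` I" "b \<noteq> b'"
    then obtain i u j v where b: "b = F (i, u)" "b' = F (j, v)"
      and ij: "i \<in> {1..?d}" "j \<in> {1..?d}" and uv: "u \<in> T i" "v \<in> T j" "i = j \<longrightarrow> u \<noteq> v"
      unfolding I_def by blast
    consider "i \<noteq> j" | "i = j" "i = 1" | "i = j" "i \<noteq> 1"
      by blast
    then show "?\<beta> b b' = 0"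
    proof cases
      case 1
      then show ?thesis
        using \<beta>F[OF ij] by (cases u, cases v) (simp add: b)
    next
      case 2
      then have "u = t1 \<and> v = t2 \<or> u = t2 \<and> v = t1"
        using uv by (simp add: T_def) blast
      then show ?thesis
        using \<beta>12 2 by (auto simp: b)
    next
      case 3
      then have "u \<in> E" "v \<in> E" "u \<noteq> v"
        using uv by (simp_all add: T_def)
      then show ?thesis
        by (auto simp: b E_def \<beta>F[OF ij] split: if_splits)
    qed
  qed
  have posF: "\<forall>b\<in>F ` I. ?\<beta> b b > 0"
  proof
    fix b assume "b \<in> F ` I"
    then obtain i u where b: "b = F (i, u)" "i \<in> {1..?d}" "u \<in> T i"
      unfolding I_def by blast
    show "?\<beta> b b > 0"
    proof (cases "i = 1")
      case True
      have "L * l * c / (\<mu> * n\<^sup>2) > 0"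
        using pos saddle_constants_pos n(1) by simp
      moreover have "u = t1 \<or> u = t2"
        using b(3) True by (simp add: T_def)
      ultimately show ?thesis
        using \<beta>1 \<beta>2 pos(1) b(1) True by metis
    next
      case False
      then have "i \<in> {2..?d}" "u \<in> E"
        using b by (auto simp: T_def)
      then show ?thesis
        using \<beta>E lam pos(1) b(1) by (auto simp: E_def)
    qed
  qed
  have "(LINT z:S|surface_measure S. exp (- quad_hamiltonian U L \<sigma> l lam e z / \<epsilon>))
      = (LINT z:S|surface_measure S. exp (- U \<sigma> / \<epsilon>) *
          exp (- ?\<beta> (z - (\<sigma>, 0, 0)) (z - (\<sigma>, 0, 0)) / (2 * \<epsilon>)))"
  proof -
    have "- (u + b / 2) / \<epsilon> = - u / \<epsilon> + - b / (2 * \<epsilon>)" for u b :: real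
      by (simp add: diff_divide_distrib)
    then show ?thesis
      unfolding quad_hamiltonian_eq D_def[symmetric] exp_add[symmetric] by presburger
  qed
  also have "\<dots> = exp (- U \<sigma> / \<epsilon>) * (\<Prod>b\<in>F ` I. sqrt (K / ?\<beta> b b))"
    using surface_integral_gaussian[OF frame bilinear_saddle_form \<open>\<epsilon> > 0\<close> diag posF] by (simp add: K_def)
  also have "(\<Prod>b\<in>F ` I. sqrt (K / ?\<beta> b b)) = (\<Prod>x\<in>I. sqrt (K / ?\<beta> (F x) (F x)))"
    by (simp add: prod.reindex[OF inj])
  also have "\<dots> = (\<Prod>i=1..?d. \<Prod>u\<in>T i. sqrt (K / ?\<beta> (F (i, u)) (F (i, u))))"
    unfolding I_def using T(1) by (subst prod.Sigma) (auto intro!: prod.cong)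
  also have "\<dots> = (\<Prod>u\<in>T 1. sqrt (K / ?\<beta> (F (1, u)) (F (1, u)))) *
      (\<Prod>i=2..?d. \<Prod>u\<in>T i. sqrt (K / ?\<beta> (F (i, u)) (F (i, u))))"
    unfolding range by (rule prod.insert) auto
  also have "(\<Prod>i=2..?d. \<Prod>u\<in>T i. sqrt (K / ?\<beta> (F (i, u)) (F (i, u)))) = (\<Prod>i=2..?d. sqrt (K / lam i) * (K / L))"
  proof (intro prod.cong refl)
    fix i assume i: "i \<in> {2..?d}"
    have "(\<Prod>u\<in>T i. sqrt (K / ?\<beta> (F (i, u)) (F (i, u)))) = sqrt (K / lam i) * (sqrt (K / L) * sqrt (K / L))"
      using i \<beta>E[OF i] by (simp add: T_def E_def)
    then show "(\<Prod>u\<in>T i. sqrt (K / ?\<beta> (F (i, u)) (F (i, u)))) = sqrt (K / lam i) * (K / L)"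
      using \<open>\<epsilon> > 0\<close> pos(1) by (simp add: K_def)
  qed
  also have "(\<Prod>u\<in>T 1. sqrt (K / ?\<beta> (F (1, u)) (F (1, u)))) = sqrt (K / L) * sqrt (K / (L * l * c / (\<mu> * n\<^sup>2)))"
  proof -
    have "(\<Prod>u\<in>{t1, t2}. sqrt (K / ?\<beta> (F (1, u)) (F (1, u))))
        = sqrt (K / ?\<beta> (F (1, t1)) (F (1, t1))) * sqrt (K / ?\<beta> (F (1, t2)) (F (1, t2)))"
      using \<open>t1 \<noteq> t2\<close> by simp
    then show ?thesis
      unfolding \<beta>1 \<beta>2 by (simp add: T_def)
  qed
  also have "\<dots> = sqrt ((K / L * n)\<^sup>2 * (\<mu> / (l * c)))"
    unfolding real_sqrt_mult[symmetric] by (simp add: field_simps power2_eq_square)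
  also have "\<dots> = K / L * sqrt (\<mu> / (l * c)) * n"
  proof -
    have "K / L * n \<ge> 0"
      using n(1) pos(1) \<open>\<epsilon> > 0\<close> by (simp add: K_def)
    then show ?thesis
      by (simp only: real_sqrt_mult real_sqrt_abs abs_of_nonneg mult_ac)
  qed
  finally show "(LINT z:S|surface_measure S. exp (- quad_hamiltonian U L \<sigma> l lam e z / \<epsilon>))
      = exp (- U \<sigma> / \<epsilon>) * (\<Prod>i=2..CARD('n). sqrt (K / lam i) * (K / L))
          * (K / L * sqrt (\<mu> / (l * c)) * sqrt (\<alpha>\<^sup>2 + 1 + \<zeta>\<^sup>2))"
    by (simp add: n_def mult_ac)
qed

text \<open>The factors \<open>\<surd>(\<alpha>\<^sup>2 + 1 + \<zeta>\<^sup>2)\<close> of the unit normal and of the surface element cancel, and so does \<open>c\<close>: up to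
factors free of \<open>\<mu>\<close>, \<open>c\<close> and \<open>l\<close>, the derivative of \<^term>\<open>Phi_sigma\<close> at \<open>0\<close> contributes \<open>\<surd>(\<mu> / c)\<close>, the flux \<open>c\<close> and the integral \<open>\<surd>(\<mu> / (l c))\<close>.\<close>
lemma quad_current_eq:
  fixes e :: "nat \<Rightarrow> real^'n" and \<sigma> :: "real^'n"
  assumes orth: "orthonormal_family {1..CARD('n)} e"
    and lam: "\<forall>i\<in>{2..CARD('n)}. lam i > 0" and "\<epsilon> > 0"
  shows "quad_current U L \<gamma> \<sigma> l lam e \<epsilon> = 1 / partition_fn U L \<epsilon> *
           ((2 * pi * \<epsilon>) powr (3 * real CARD('n) / 2) / L ^ CARD('n)) *
           (\<mu> / (2 * pi * sqrt (l * (\<Prod>i=2..CARD('n). lam i)))) * exp (- U \<sigma> / \<epsilon>)"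
proof -
  define S where "S = Sigma_lin L \<gamma> \<sigma> l (e 1)"
  define K where "K = 2 * pi * \<epsilon>"
  define n where "n = sqrt (\<alpha>\<^sup>2 + 1 + \<zeta>\<^sup>2)"
  define P where "P = (\<Prod>i=2..CARD('n). lam i)"
  have "K > 0"
    using \<open>\<epsilon> > 0\<close> by (simp add: K_def)
  have "n > 0"
    by (auto simp: n_def add_nonneg_pos add_pos_nonneg)
  note S = saddle_surface_integral(1)[OF orth lam \<open>\<epsilon> > 0\<close>, of \<sigma>, folded S_def]
    saddle_surface_integral(2)[OF orth lam \<open>\<epsilon> > 0\<close>, of \<sigma> U, folded S_def K_def n_def]
  have "norm (e 1) = 1"
    using orth by (auto simp: norm_eq_1 Suc_leI)
  then have "quad_current U L \<gamma> \<sigma> l lam e \<epsilon> = 1 / partition_fn U L \<epsilon> *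
      (LINT z:S|surface_measure S. (\<epsilon> * sqrt (\<mu> / (2 * pi * c)) / sqrt \<epsilon> * c / n) *
         exp (- quad_hamiltonian U L \<sigma> l lam e z / \<epsilon>))"
    unfolding quad_current_def S_def[symmetric]
    by (intro arg_cong2[where f = "(*)"] set_lebesgue_integral_cong S(1))
       (auto simp: S_def Sigma_lin_def current_density n_def)
  also have "\<dots> = 1 / partition_fn U L \<epsilon> * ((\<epsilon> * sqrt (\<mu> / (2 * pi * c)) / sqrt \<epsilon> * c / n) *
      (exp (- U \<sigma> / \<epsilon>) * (\<Prod>i=2..CARD('n). sqrt (K / lam i) * (K / L)) * (K / L * sqrt (\<mu> / (l * c)) * n)))"
    by (simp only: set_integral_mult_right S(2))
  also have "\<dots> = 1 / partition_fn U L \<epsilon> * exp (- U \<sigma> / \<epsilon>) *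
      (\<Prod>i=2..CARD('n). sqrt (K / lam i) * (K / L)) *
      (K / L * (\<epsilon> / sqrt \<epsilon>) * (c * (sqrt (\<mu> / (2 * pi * c)) * sqrt (\<mu> / (l * c)))))"
    using \<open>n > 0\<close> by (simp add: mult_ac)
  also have "\<epsilon> / sqrt \<epsilon> = sqrt K / sqrt (2 * pi)"
    using \<open>\<epsilon> > 0\<close> by (simp add: real_div_sqrt K_def real_sqrt_mult)
  also have "c * (sqrt (\<mu> / (2 * pi * c)) * sqrt (\<mu> / (l * c))) = \<mu> / (sqrt (2 * pi) * sqrt l)"
    using saddle_constants_pos pos by (simp add: real_sqrt_divide real_sqrt_mult field_simps)
  also have "K / L * (sqrt K / sqrt (2 * pi)) * (\<mu> / (sqrt (2 * pi) * sqrt l)) = (sqrt K ^ 3 / L) * (\<mu> / (2 * pi * sqrt l))"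
    using \<open>K > 0\<close> by (simp add: power3_eq_cube)
  also have "(\<Prod>i=2..CARD('n). sqrt (K / lam i) * (K / L)) = (sqrt K ^ 3 / L) ^ (CARD('n) - 1) / sqrt P"
  proof -
    have "(\<Prod>i=2..CARD('n). sqrt (K / lam i) * (K / L)) = (\<Prod>i=2..CARD('n). (sqrt K ^ 3 / L) / sqrt (lam i))"
      using \<open>K > 0\<close> by (intro prod.cong refl) (simp add: real_sqrt_divide power3_eq_cube mult_ac)
    also have "\<dots> = (sqrt K ^ 3 / L) ^ (CARD('n) - 1) / (\<Prod>i=2..CARD('n). sqrt (lam i))"
      by (simp only: prod_dividef prod_constant card_atLeastAtMost power_divide) simp
    also have "(\<Prod>i=2..CARD('n). sqrt (lam i)) = sqrt P"
      unfolding P_def by (induction rule: infinite_finite_induct) (auto simp: real_sqrt_mult)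
    finally show ?thesis .
  qed
  also have "1 / partition_fn U L \<epsilon> * exp (- U \<sigma> / \<epsilon>) * ((sqrt K ^ 3 / L) ^ (CARD('n) - 1) / sqrt P) *
        ((sqrt K ^ 3 / L) * (\<mu> / (2 * pi * sqrt l)))
      = 1 / partition_fn U L \<epsilon> * (sqrt K ^ 3 / L) ^ CARD('n) * (\<mu> / (2 * pi * sqrt (l * P))) * exp (- U \<sigma> / \<epsilon>)"
    by (simp add: real_sqrt_mult power_eq_if[of _ "CARD('n)"] mult_ac)
  also have "(sqrt K ^ 3 / L) ^ CARD('n) = K powr (3 * real CARD('n) / 2) / L ^ CARD('n)"
    using \<open>K > 0\<close>
    by (simp add: power_divide power_mult[symmetric] powr_half_sqrt[symmetric] powr_power)
       (simp add: mult.commute)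
  finally show ?thesis
    by (simp add: K_def P_def)
qed

end

section \<open>The current in terms of the Hessian\<close>

text \<open>The determinant is compared with that of the diagonal matrix of eigenvalues through \<open>A P = P Q\<close>, where
the columns of \<open>P\<close> are the eigenvectors; \<open>P\<close> is orthogonal, so its determinant cancels.\<close>

lemma det_eq_prod_eigenvalues:
  fixes A :: "real^'n^'n"
  assumes orth: "orthonormal_family {1..CARD('n)} e"
    and eigen: "\<forall>i\<in>{1..CARD('n)}. A *v e i = D i *\<^sub>R e i"
  shows "det A = (\<Prod>i=1..CARD('n). D i)"
proof -
  obtain f :: "'n \<Rightarrow> nat" where f: "bij_betw f UNIV {1..CARD('n)}"
    using ex_bij_betw_finite_nat[of "UNIV :: 'n set"] ex_bij_betw_nat_finite_1[of "UNIV :: 'n set"]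
    by (metis bij_betw_inv finite)
  then have f_in: "f j \<in> {1..CARD('n)}" for j
    using bij_betwE by blast
  have f_eq: "f i = f j \<longleftrightarrow> i = j" for i j
    using f by (auto simp: bij_betw_def inj_eq)
  define P :: "real^'n^'n" where "P = (\<chi> i j. e (f j) $ i)"
  define Q :: "real^'n^'n" where "Q = (\<chi> i j. if i = j then D (f j) else 0)"
  have "transpose P ** P = mat 1"
  proof -
    have "(transpose P ** P) $ i $ j = e (f i) \<bullet> e (f j)" for i j
      by (simp add: P_def matrix_matrix_mult_def transpose_def inner_vec_def)
    then show ?thesis
      using orth f_in by (simp add: vec_eq_iff mat_def f_eq)
  qed
  then have "det P \<noteq> 0"
    by (metis det_I det_mul mult_zero_right zero_neq_one)
  have "A ** P = P ** Q"
  proof -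
    have "(A ** P) $ i $ j = (A *v e (f j)) $ i" for i j
      by (simp add: P_def matrix_matrix_mult_def matrix_vector_mult_def)
    moreover have "(P ** Q) $ i $ j = D (f j) * e (f j) $ i" for i j
      by (simp add: P_def Q_def matrix_matrix_mult_def if_distrib cong: if_cong)
    ultimately show ?thesis
      using eigen f_in by (simp add: vec_eq_iff)
  qed
  then have "det A = det Q"
    using \<open>det P \<noteq> 0\<close> by (metis det_mul mult.commute mult_cancel_left)
  also have "\<dots> = (\<Prod>j\<in>UNIV. D (f j))"
    by (subst det_diagonal) (auto simp: Q_def)
  also have "\<dots> = (\<Prod>i=1..CARD('n). D i)"
    by (rule prod.reindex_bij_betw[OF f])
  finally show ?thesis .
qed
theorem proposition3p8:
  fixes U :: "real^'n \<Rightarrow> real" and m s \<sigma> :: "real^'n"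
    and L \<gamma> \<epsilon> l\<^sub>\<sigma> :: real and lam :: "nat \<Rightarrow> real" and e :: "nat \<Rightarrow> real^'n"
  assumes "L > 0" and "\<gamma> > 0" and "\<epsilon> > 0"
    and "double_well U m s \<sigma>"
    and "saddle_eigenbasis (hess U \<sigma>) l\<^sub>\<sigma> lam e"
  shows "quad_current U L \<gamma> \<sigma> l\<^sub>\<sigma> lam e \<epsilon> =
           1 / partition_fn U L \<epsilon> *
           ((2 * pi * \<epsilon>) powr (3 * real CARD('n) / 2) / L ^ CARD('n)) *
           (mu_sigma L \<gamma> l\<^sub>\<sigma> / (2 * pi * sqrt (- det (hess U \<sigma>)))) * exp (- U \<sigma> / \<epsilon>)
       \<and> 1 / partition_fn U L \<epsilon> *
           ((2 * pi * \<epsilon>) powr (3 * real CARD('n) / 2) / L ^ CARD('n)) *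
           (mu_sigma L \<gamma> l\<^sub>\<sigma> / (2 * pi * sqrt (- det (hess U \<sigma>)))) * exp (- U \<sigma> / \<epsilon>)
         = mu_sigma L \<gamma> l\<^sub>\<sigma> / (2 * pi * sqrt (- det (hess U \<sigma>))) * K_sigma U L \<sigma> \<epsilon>"
proof -
  let ?D = "lam(1 := - l\<^sub>\<sigma>)"
  have orth: "orthonormal_family {1..CARD('n)} e"
    and "l\<^sub>\<sigma> > 0" and e1: "hess U \<sigma> *v e 1 = (- l\<^sub>\<sigma>) *\<^sub>R e 1"
    and lam: "\<forall>i\<in>{2..CARD('n)}. lam i > 0"
    and ei: "\<forall>i\<in>{2..CARD('n)}. hess U \<sigma> *v e i = lam i *\<^sub>R e i"
    using assms(5) unfolding saddle_eigenbasis_def by blast+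
  have "\<forall>i\<in>{1..CARD('n)}. hess U \<sigma> *v e i = ?D i *\<^sub>R e i"
    using e1 ei by auto
  then have "det (hess U \<sigma>) = (\<Prod>i=1..CARD('n). ?D i)"
    by (rule det_eq_prod_eigenvalues[OF orth])
  also have "\<dots> = ?D 1 * (\<Prod>i=2..CARD('n). ?D i)"
    using prod.atLeast_Suc_atMost[of 1 "CARD('n)" ?D] by (simp add: numeral_2_eq_2)
  also have "(\<Prod>i=2..CARD('n). ?D i) = (\<Prod>i=2..CARD('n). lam i)"
    by (intro prod.cong) auto
  finally have det: "- det (hess U \<sigma>) = l\<^sub>\<sigma> * (\<Prod>i=2..CARD('n). lam i)"
    by simp
  interpret saddle_parameters L \<gamma> l\<^sub>\<sigma>
    by standard (use assms \<open>l\<^sub>\<sigma> > 0\<close> in auto)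
  show ?thesis
    unfolding det using quad_current_eq[OF orth lam assms(3), of U \<sigma>]
    by (simp add: K_sigma_def inverse_eq_divide mult_ac)
qed

end
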